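(* Let $\Lambda=(\lambda_1,\dots,\lambda_r)$, $\mathbf{x}=(x_1,\dots,x_n)$, let $F(\Lambda,\mathbf{x})$ be an Elliott-rational function, and let $\le^\rho$ be a total order on $\mathbb{Z}^{n+r}$ (equivalently on the monomials in $\Lambda,\mathbf{x}$) compatible with its additive group structure. Then, as rational functions, $$\mathop{\mathrm{CT}}_{\Lambda}{}^{\bar\rho}F=(-1)^r\mathop{\mathrm{CT}}_\Lambda{}^{\rho}F+\sum_{i=0}^{r-1}(-1)^i\mathop{\mathrm{CT}}_{\lambda_r,\dots,\lambda_{i+2}}{}^{\bar\rho}\;\mathcal{I}_{\lambda_{i+1}}\mathop{\mathrm{CT}}_{\lambda_i,\dots,\lambda_1}{}^{\rho}F,$$ where $\mathop{\mathrm{CT}}^{\rho}_{\lambda_i,\dots,\lambda_1}$ is the identity operator for $i=0$ and $\mathop{\mathrm{CT}}^{\bar\rho}_{\lambda_r,\dots,\lambda_{i+2}}$ is the identity operator for $i=r-1$.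
   Context: An Elliott-rational function is one of the form $p/\prod_{i=1}^m(y_i-z_i)$ with $p$ a polynomial in $\Lambda,\mathbf{x}$ and $y_i\ne z_i$ monomials. For a compatible total order $\preceq^\rho$ on monomials, the formal series with well-ordered support form a field containing all rational functions, so each rational function has a unique expansion; $\mathop{\mathrm{CT}}^\rho_{\lambda}G$ is the coefficient of $\lambda^0$ in the expansion of $G$. Constant terms of Elliott-rational functions in one $\lambda_j$ are again (expansions of) Elliott-rational functions, and iterated operators $\mathop{\mathrm{CT}}^\rho_{\lambda_i,\dots,\lambda_1}$ mean: take $\mathop{\mathrm{CT}}^\rho_{\lambda_1}$ first, then $\lambda_2$, etc., each time regarding the result as a rational function; $\mathop{\mathrm{CT}}^\rho_\Lambda=\mathop{\mathrm{CT}}^\rho_{\lambda_r,\dots,\lambda_1}$. $\preceq^{\bar\rho}$ is the reverse order ($m_1\prec^{\bar\rho}m_2$ iff $m_1\succ^\rho m_2$), with $\mathop{\mathrm{CT}}^{\bar\rho}$ defined analogously. For a rational function $G$ and variable $\lambda$, with $K$ the field of rational functions in the other variables, $\mathcal{I}_\lambda G=\mathop{\mathrm{CT}}_{\lambda=0}G+\mathop{\mathrm{CT}}_{\lambda=\infty}G$, the constant terms of $G$ expanded in $K((\lambda))$ and in $K((\lambda^{-1}))$ respectively. *)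

theory Defs
  imports
    "HOL-Library.Poly_Mapping"
    "HOL-Computational_Algebra.Fraction_Field"
    "HOL-Computational_Algebra.Formal_Laurent_Series"
begin

text \<open>
  Variables are natural numbers; a finite set \<open>V\<close> of them is fixed in each definition. For
  \<open>\<lambda>\<^sub>1, \<dots>, \<lambda>\<^sub>r, x\<^sub>1, \<dots>, x\<^sub>n\<close> one takes \<open>V = {1..r + n}\<close>, where \<open>\<lambda>\<^sub>j\<close> is the variable \<open>j\<close> and
  \<open>x\<^sub>k\<close> is the variable \<open>r + k\<close>.
\<close>

type_synonym 'k mpoly = "(nat \<Rightarrow>\<^sub>0 nat) \<Rightarrow>\<^sub>0 'k"
type_synonym 'k ratfun = "'k mpoly fract"
type_synonym expvec = "nat \<Rightarrow>\<^sub>0 int"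
type_synonym 'k series = "expvec \<Rightarrow> 'k"

definition polys :: "nat set \<Rightarrow> 'k::field mpoly set" where
  "polys V = {p. \<forall>m\<in>Poly_Mapping.keys p. Poly_Mapping.keys m \<subseteq> V}"

definition ratfuns :: "nat set \<Rightarrow> 'k::field ratfun set" where
  "ratfuns V = {Fraction_Field.Fract p q | p q. p \<in> polys V \<and> q \<in> polys V \<and> q \<noteq> 0}"

text \<open>A monomial is given by its exponent vector \<open>e\<close> and is \<open>Poly_Mapping.single e 1\<close>.\<close>

definition elliott_rational :: "nat set \<Rightarrow> 'k::field ratfun set" where
  "elliott_rational V =
    {Fraction_Field.Fract p (\<Prod>i<m. Poly_Mapping.single (y i) 1 - Poly_Mapping.single (z i) 1) | p (m::nat) y z.
      p \<in> polys V \<and> (\<forall>i<m. Poly_Mapping.keys (y i) \<subseteq> V \<and> Poly_Mapping.keys (z i) \<subseteq> V \<and> y i \<noteq> z i)}"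


subsection \<open>Compatible orders and series with well-ordered support\<close>

definition expvecs :: "nat set \<Rightarrow> expvec set" where
  "expvecs V = {a. Poly_Mapping.keys a \<subseteq> V}"

text \<open>\<open>(a, b) \<in> \<rho>\<close> means \<open>a \<preceq>\<^sup>\<rho> b\<close>; the reverse order is the converse relation \<open>\<rho>\<inverse>\<close>.\<close>

definition compatible_order :: "nat set \<Rightarrow> expvec rel \<Rightarrow> bool" where
  "compatible_order V \<rho> \<longleftrightarrow> linear_order_on (expvecs V) \<rho> \<and>
    (\<forall>a b. \<forall>c\<in>expvecs V. (a, b) \<in> \<rho> \<longrightarrow> (a + c, b + c) \<in> \<rho>)"

definition supp :: "'k::field series \<Rightarrow> expvec set" where
  "supp S = {a. S a \<noteq> 0}"

definition mn_series :: "nat set \<Rightarrow> expvec rel \<Rightarrow> 'k::field series set" where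
  "mn_series V \<rho> = {S. supp S \<subseteq> expvecs V \<and> well_order_on (supp S) (Restr \<rho> (supp S))}"

text \<open>For series with well-ordered support (Malcev--Neumann series) the index set of the sum is finite.\<close>

definition mn_mult :: "'k::field series \<Rightarrow> 'k series \<Rightarrow> 'k series" where
  "mn_mult S T = (\<lambda>a. \<Sum>(b, c) \<in> {(b, c). b \<in> supp S \<and> c \<in> supp T \<and> b + c = a}. S b * T c)"

definition series_of_poly :: "'k::field mpoly \<Rightarrow> 'k series" where
  "series_of_poly p =
    (\<lambda>a. if \<forall>v. Poly_Mapping.lookup a v \<ge> 0
         then Poly_Mapping.lookup p (Poly_Mapping.map nat a) else 0)"

text \<open>
  The expansion of \<open>p / q\<close> is the quotient of \<open>p\<close> by \<open>q\<close> in the field of series with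
  well-ordered support. Only rational functions in \<open>ratfuns V\<close> have one.
\<close>

definition expansion :: "nat set \<Rightarrow> expvec rel \<Rightarrow> 'k::field ratfun \<Rightarrow> 'k series" where
  "expansion V \<rho> G = (THE S. S \<in> mn_series V \<rho> \<and>
    (\<exists>p q. p \<in> polys V \<and> q \<in> polys V \<and> q \<noteq> 0 \<and> G = Fraction_Field.Fract p q \<and>
      mn_mult (series_of_poly q) S = series_of_poly p))"

definition series_CT :: "nat \<Rightarrow> 'k::field series \<Rightarrow> 'k series" where
  "series_CT j S = (\<lambda>a. if Poly_Mapping.lookup a j = 0 then S a else 0)"

text \<open>
  The constant term in the variable \<open>j\<close>, regarded as a rational function again: the rational
  function whose expansion is the constant term of the expansion of \<open>G\<close>. It is unique because
  expansion is injective on \<open>ratfuns V\<close>, and it exists when \<open>G\<close> is Elliott-rational; for other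
  \<open>G\<close> the value may be unspecified.
\<close>

definition CT :: "nat set \<Rightarrow> expvec rel \<Rightarrow> nat \<Rightarrow> 'k::field ratfun \<Rightarrow> 'k ratfun" where
  "CT V \<rho> j G =
    (THE R. R \<in> ratfuns V \<and> expansion V \<rho> R = series_CT j (expansion V \<rho> G))"


subsection \<open>Constant terms at zero and at infinity\<close>

definition const_ratfun :: "'k::field \<Rightarrow> 'k ratfun" where
  "const_ratfun c = Fraction_Field.Fract (Poly_Mapping.single 0 c) 1"

definition var_ratfun :: "nat \<Rightarrow> 'k::field ratfun" where
  "var_ratfun v = Fraction_Field.Fract (Poly_Mapping.single (Poly_Mapping.single v 1) 1) 1"

text \<open>
  \<open>p\<close> as a Laurent series over the field of rational functions, with the variable \<open>j\<close> replaced by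
  \<open>t\<close>. All coefficients of the results below lie in the subfield \<open>K\<close> of rational functions in the
  variables other than \<open>j\<close>.
\<close>

definition laurent_of_poly :: "nat \<Rightarrow> 'k::field ratfun fls \<Rightarrow> 'k mpoly \<Rightarrow> 'k ratfun fls" where
  "laurent_of_poly j t p = (\<Sum>m\<in>Poly_Mapping.keys p. fls_const (const_ratfun (Poly_Mapping.lookup p m)) *
    (\<Prod>v\<in>Poly_Mapping.keys m. (if v = j then t else fls_const (var_ratfun v)) ^ Poly_Mapping.lookup m v))"

definition laurent_expansion :: "nat \<Rightarrow> 'k::field ratfun fls \<Rightarrow> 'k ratfun \<Rightarrow> 'k ratfun fls" where
  "laurent_expansion j t G = (THE L. \<exists>p q. q \<noteq> 0 \<and> G = Fraction_Field.Fract p q \<and>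
    L = laurent_of_poly j t p / laurent_of_poly j t q)"

definition CT_zero :: "nat \<Rightarrow> 'k::field ratfun \<Rightarrow> 'k ratfun" where
  "CT_zero j G = fls_nth (laurent_expansion j fls_X G) 0"

text \<open>In \<open>K((\<lambda>\<inverse>))\<close> the Laurent series indeterminate stands for \<open>\<lambda>\<inverse>\<close>.\<close>

definition CT_infinity :: "nat \<Rightarrow> 'k::field ratfun \<Rightarrow> 'k ratfun" where
  "CT_infinity j G = fls_nth (laurent_expansion j fls_X_inv G) 0"

definition CT_I :: "nat \<Rightarrow> 'k::field ratfun \<Rightarrow> 'k ratfun" where
  "CT_I j G = CT_zero j G + CT_infinity j G"

end

(* Let A, B be monomials with A, B > 1 in the order rho whose exponents of lambda have opposite signs.
   After replacing them by suitable powers, A B is free of lambda, and Elliott's identity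
   1/((1-A)(1-B)) = (1/(1-A) + 1/(1-B) - 1)/(1-AB) lowers the number of denominator factors that
   contain lambda. Hence an Elliott-rational function is a sum of terms in whose denominators all
   exponents of lambda have the same sign. For such a term the expansion with respect to rho has the
   same constant term in lambda as one of the two Laurent expansions at 0 and at infinity, and the
   expansion with respect to the reverse order has that of the other one. So
   CT^{rho-bar} = - CT^rho + I in each variable, on a class closed under all these operators, and the
   theorem follows by replacing CT^{rho-bar} by CT^rho one variable at a time.

   The operator CT is a definite description, so rational functions other than Elliott-rational ones
   matter too: expansions have to exist and to be injective on all of them. *)
theory Submission
  imports Defs "HOL-Library.Ramsey"
begin

text \<open>The field of series with well-ordered support is never constructed. Only the action of
  Laurent polynomials on series is used: it has no torsion, because lowest terms multiply, and it
  allows division by any nonzero Laurent polynomial, once its lowest term is factored out. The first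
  fact makes expansions unique, the second makes them exist, and a series S is recognised as the
  expansion of P/Q by checking Q S = P. Laurent polynomials are the working ring because reversing
  the order inverts monomials. The closed class consists of Laurent polynomials over products of
  factors 1 - A with A a nontrivial monomial: y - z is y (1 - z/y), and 1 - A is -A (1 - 1/A), so
  factors can be normalised for either order inside the class. Denominators of one sign do not yet
  settle the constant term, since the numerator may have exponents of both signs. Division with
  remainder with respect to lambda separates these, and the constant term becomes an explicit
  quotient that lies in the class again.\<close>

abbreviation keys where "keys \<equiv> Poly_Mapping.keys"
abbreviation lookup where "lookup \<equiv> Poly_Mapping.lookup"
abbreviation single where "single \<equiv> Poly_Mapping.single"

type_synonym 'k lpoly = "expvec \<Rightarrow>\<^sub>0 'k"

subsection \<open>Evaluation of monoid algebra elements\<close>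

lemma sum_single_lookup: "(\<Sum>a\<in>keys P. single a (lookup P a)) = P"
  by (rule poly_mapping_eqI) (simp add: lookup_sum lookup_single when_def in_keys_iff)

lemma poly_mapping_additive_induct [case_names single add]:
  assumes single: "\<And>a c. Q (single a c)"
    and add: "\<And>p q. Q p \<Longrightarrow> Q q \<Longrightarrow> Q (p + q)"
  shows "Q (P :: 'a \<Rightarrow>\<^sub>0 'b::comm_monoid_add)"
proof -
  have "Q (\<Sum>a\<in>A. single a (lookup P a))" if "finite A" for A
    using that
  proof (induction A)
    case empty
    then show ?case using single[of undefined 0] by simp
  qed (simp add: single add)
  from this[of "keys P"] show ?thesis by (simp add: sum_single_lookup)
qed

lemma sum_keys_superset:
  assumes "finite A" "keys P \<subseteq> A" "\<And>a. f a 0 = 0"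
  shows "(\<Sum>a\<in>keys P. f a (lookup P a)) = (\<Sum>a\<in>A. f a (lookup P a))"
  by (rule sum.mono_neutral_left) (use assms in \<open>auto simp: in_keys_iff\<close>)

lemma sum_keys_add:
  assumes "\<And>a. f a 0 = 0" "\<And>a c d. f a (c + d) = f a c + f a d"
  shows "(\<Sum>a\<in>keys (P + Q). f a (lookup (P + Q) a)) =
    (\<Sum>a\<in>keys P. f a (lookup P a)) + (\<Sum>a\<in>keys Q. f a (lookup Q a))"
proof -
  let ?A = "keys P \<union> keys Q"
  have A: "finite ?A" by simp
  show ?thesis
    using sum_keys_superset[where f=f, OF A _ assms(1), of "P + Q"]
      sum_keys_superset[where f=f, OF A _ assms(1), of P] sum_keys_superset[where f=f, OF A _ assms(1), of Q]
      keys_add[of P Q]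
    by (simp add: lookup_add assms(2) sum.distrib)
qed

text \<open>Under the assumptions of the locale below this is a ring homomorphism. It is used three
  times: from polynomials to Laurent polynomials, and from Laurent polynomials to rational functions
  and to Laurent series in one variable.\<close>

definition eval_monoid_algebra ::
    "('k::zero \<Rightarrow> 'r) \<Rightarrow> ('a \<Rightarrow> 'r) \<Rightarrow> ('a \<Rightarrow>\<^sub>0 'k) \<Rightarrow> 'r::comm_ring_1" where
  "eval_monoid_algebra c \<mu> P = (\<Sum>a\<in>keys P. c (lookup P a) * \<mu> a)"

locale monoid_algebra_eval =
  fixes c :: "'k::comm_ring_1 \<Rightarrow> 'r::comm_ring_1" and \<mu> :: "'a::comm_monoid_add \<Rightarrow> 'r"
  assumes c_add: "c (x + y) = c x + c y"
    and c_mult: "c (x * y) = c x * c y"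
    and c_one: "c 1 = 1"
    and \<mu>_zero: "\<mu> 0 = 1"
    and \<mu>_add: "\<mu> (a + b) = \<mu> a * \<mu> b"
begin

abbreviation "ev \<equiv> eval_monoid_algebra c \<mu>"

lemma c_zero: "c 0 = 0"
  using c_add[of 0 0] by simp

lemma ev_single: "ev (single a x) = c x * \<mu> a"
  by (cases "x = 0") (simp_all add: eval_monoid_algebra_def c_zero)

lemma ev_zero: "ev 0 = 0"
  by (simp add: eval_monoid_algebra_def)

lemma ev_one: "ev 1 = 1"
  by (simp flip: single_one add: ev_single \<mu>_zero c_one)

lemma ev_add: "ev (P + Q) = ev P + ev Q"
  unfolding eval_monoid_algebra_def
  by (rule sum_keys_add[where f="\<lambda>a x. c x * \<mu> a"]) (simp_all add: c_zero c_add algebra_simps)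

lemma ev_uminus: "ev (- P) = - ev P"
  using ev_add[of P "- P"] by (simp add: ev_zero add_eq_0_iff)

lemma ev_diff: "ev (P - Q) = ev P - ev Q"
  using ev_add[of P "- Q"] by (simp add: ev_uminus)

lemma ev_mult: "ev (P * Q) = ev P * ev Q"
proof (induction P rule: poly_mapping_additive_induct)
  case (single a x)
  show ?case
    by (induction Q rule: poly_mapping_additive_induct)
      (simp_all add: ev_add ev_single mult_single c_mult \<mu>_add algebra_simps)
qed (simp add: ev_add algebra_simps)

lemma ev_sum: "ev (\<Sum>i\<in>A. f i) = (\<Sum>i\<in>A. ev (f i))"
  by (induction A rule: infinite_finite_induct) (simp_all add: ev_zero ev_add)

lemma ev_prod: "ev (\<Prod>i\<in>A. f i) = (\<Prod>i\<in>A. ev (f i))"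
  by (induction A rule: infinite_finite_induct) (simp_all add: ev_one ev_mult)

end

subsection \<open>Series as a module over Laurent polynomials\<close>

text \<open>The product of a Laurent polynomial and a series. The sum is over the finite support of
  \<open>P\<close>, so the module laws hold for arbitrary coefficient functions.\<close>

definition act :: "'k::field lpoly \<Rightarrow> 'k series \<Rightarrow> 'k series" where
  "act P S = (\<lambda>a. \<Sum>b\<in>keys P. lookup P b * S (a - b))"

lemma act_single: "act (single b c) S = (\<lambda>a. c * S (a - b))"
  by (cases "c = 0") (simp_all add: act_def)

lemma act_add_left: "act (P + Q) S = (\<lambda>a. act P S a + act Q S a)"
  unfolding act_def
  by (rule ext, rule sum_keys_add[where f="\<lambda>b c. c * S (_ - b)"]) (simp_all add: algebra_simps)

lemma act_uminus_left: "act (- P) S = (\<lambda>a. - act P S a)"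
  by (simp add: act_def sum_negf)

lemma act_diff_left: "act (P - Q) S = (\<lambda>a. act P S a - act Q S a)"
  using act_add_left[of P "- Q" S] by (simp add: act_uminus_left)

lemma act_one_left: "act 1 S = S"
  by (simp flip: single_one add: act_single)

lemma act_add_right: "act P (\<lambda>a. S a + T a) = (\<lambda>a. act P S a + act P T a)"
  by (simp add: act_def algebra_simps sum.distrib)

lemma act_diff_right: "act P (\<lambda>a. S a - T a) = (\<lambda>a. act P S a - act P T a)"
  by (simp add: act_def algebra_simps sum_subtractf)

lemma act_mult_left: "act (P * Q) S = act P (act Q S)"
proof (induction P rule: poly_mapping_additive_induct)
  case (single a x)
  show ?case
    by (induction Q rule: poly_mapping_additive_induct)
      (simp_all add: act_add_left act_single mult_single algebra_simps)
qed (simp add: act_add_left algebra_simps)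

lemma act_lookup: "act P (lookup Q) = lookup (P * Q)"
proof (induction P rule: poly_mapping_additive_induct)
  case (single a x)
  show ?case
  proof (induction Q rule: poly_mapping_additive_induct)
    case (single b y)
    have "lookup (single b y) (u - a) = lookup (single (a + b) y) u" for u
      by (auto simp: lookup_single when_def)
    then show ?case
      by (auto simp: act_single mult_single lookup_single when_def)
  qed (simp add: act_add_right lookup_add algebra_simps fun_eq_iff)
qed (simp add: act_add_left lookup_add algebra_simps fun_eq_iff)

subsection \<open>Well-ordered sets of exponent vectors\<close>

lemma zero_in_expvecs: "0 \<in> expvecs V"
  by (simp add: expvecs_def)

lemma add_in_expvecs: "a \<in> expvecs V \<Longrightarrow> b \<in> expvecs V \<Longrightarrow> a + b \<in> expvecs V"
  using keys_add[of a b] by (auto simp: expvecs_def)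

lemma uminus_in_expvecs: "a \<in> expvecs V \<Longrightarrow> - a \<in> expvecs V"
  by (auto simp: expvecs_def)

lemma diff_in_expvecs: "a \<in> expvecs V \<Longrightarrow> b \<in> expvecs V \<Longrightarrow> a - b \<in> expvecs V"
  using add_in_expvecs[of a V "- b"] uminus_in_expvecs[of b] by simp

primrec scale :: "nat \<Rightarrow> expvec \<Rightarrow> expvec" where
  "scale 0 a = 0"
| "scale (Suc n) a = scale n a + a"

lemma lookup_scale: "lookup (scale n a) v = int n * lookup a v"
  by (induction n) (simp_all add: lookup_add algebra_simps)

lemma scale_in_expvecs: "a \<in> expvecs V \<Longrightarrow> scale n a \<in> expvecs V"
  by (induction n) (simp_all add: zero_in_expvecs add_in_expvecs)

locale compatible =
  fixes V :: "nat set" and \<rho> :: "expvec rel"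
  assumes compat: "compatible_order V \<rho>"
begin

abbreviation "E \<equiv> expvecs V"

definition lt :: "expvec \<Rightarrow> expvec \<Rightarrow> bool" (infix \<open>\<sqsubset>\<close> 50) where
  "a \<sqsubset> b \<longleftrightarrow> (a, b) \<in> \<rho> \<and> a \<noteq> b"

lemma lin: "linear_order_on E \<rho>"
  using compat by (simp add: compatible_order_def)

lemma lt_trans: "a \<sqsubset> b \<Longrightarrow> b \<sqsubset> c \<Longrightarrow> a \<sqsubset> c"
  using lin by (auto simp: lt_def order_on_defs dest: antisymD transD)

lemma lt_asym: "a \<sqsubset> b \<Longrightarrow> \<not> b \<sqsubset> a"
  using lin by (auto simp: lt_def order_on_defs dest: antisymD)

lemma lt_irrefl: "\<not> a \<sqsubset> a"
  by (simp add: lt_def)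

lemma lt_dom: "a \<sqsubset> b \<Longrightarrow> a \<in> E \<and> b \<in> E"
  using lin by (auto simp: lt_def order_on_defs)

lemma lt_total: "a \<in> E \<Longrightarrow> b \<in> E \<Longrightarrow> a \<sqsubset> b \<or> a = b \<or> b \<sqsubset> a"
  using lin by (auto simp: lt_def order_on_defs total_on_def)

lemma lt_add: "a \<sqsubset> b \<Longrightarrow> c \<in> E \<Longrightarrow> a + c \<sqsubset> b + c"
  using compat by (auto simp: lt_def compatible_order_def)

lemma lt_add_mono: "a \<sqsubset> b \<Longrightarrow> c \<sqsubset> d \<Longrightarrow> a + c \<sqsubset> b + d"
  using lt_add[of a b c] lt_add[of c d b] lt_dom[of a b] lt_dom[of c d] lt_trans
  by (metis add.commute)

lemma lt_iff_diff_pos: "a \<in> E \<Longrightarrow> b \<in> E \<Longrightarrow> a \<sqsubset> b \<longleftrightarrow> 0 \<sqsubset> b - a"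
  using lt_add[of a b "- a"] lt_add[of 0 "b - a" a] uminus_in_expvecs[of a] by auto

lemma pos_add: "0 \<sqsubset> a \<Longrightarrow> 0 \<sqsubset> b \<Longrightarrow> 0 \<sqsubset> a + b"
  using lt_add_mono[of 0 a 0 b] by simp

text \<open>The order is total on \<open>E\<close>, so a minimal element is a least one; this form
  feeds directly into well-founded recursion.\<close>

definition well_ordered :: "expvec set \<Rightarrow> bool" where
  "well_ordered A \<longleftrightarrow> A \<subseteq> E \<and> (\<forall>B\<subseteq>A. B \<noteq> {} \<longrightarrow> (\<exists>b\<in>B. \<forall>c\<in>B. \<not> c \<sqsubset> b))"

lemma well_orderedD:
  assumes "well_ordered A" "B \<subseteq> A" "B \<noteq> {}"
  obtains b where "b \<in> B" "\<And>c. c \<in> B \<Longrightarrow> \<not> c \<sqsubset> b"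
  using assms unfolding well_ordered_def by meson

lemma wf_lt_on:
  assumes "well_ordered A"
  shows "wf {(a, b). a \<in> A \<and> b \<in> A \<and> a \<sqsubset> b}"
  unfolding wf_eq_minimal
proof (intro allI impI)
  fix Q :: "expvec set" and x assume x: "x \<in> Q"
  show "\<exists>z\<in>Q. \<forall>y. (y, z) \<in> {(a, b). a \<in> A \<and> b \<in> A \<and> a \<sqsubset> b} \<longrightarrow> y \<notin> Q"
  proof (cases "Q \<inter> A = {}")
    case False
    then show ?thesis
      using well_orderedD[OF assms, of "Q \<inter> A"] by (metis (mono_tags, lifting) IntD1 IntI Int_lower2 mem_Collect_eq case_prodD)
  qed (use x in auto)
qed

lemma mn_series_iff: "S \<in> mn_series V \<rho> \<longleftrightarrow> well_ordered (supp S)"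
proof -
  let ?A = "supp S"
  let ?R = "Restr \<rho> ?A"
  have "well_order_on ?A ?R \<longleftrightarrow> wf {(a, b). a \<in> ?A \<and> b \<in> ?A \<and> a \<sqsubset> b}" if A: "?A \<subseteq> E"
  proof -
    have "linear_order_on ?A ?R"
      using lin A unfolding order_on_defs
      by (auto simp: refl_on_def total_on_def antisym_def subset_iff intro!: trans_Int dest: transD intro: transI)
    moreover have "?R - Id = {(a, b). a \<in> ?A \<and> b \<in> ?A \<and> a \<sqsubset> b}"
      by (auto simp: lt_def)
    ultimately show ?thesis by (simp add: well_order_on_def)
  qed
  moreover have "wf {(a, b). a \<in> ?A \<and> b \<in> ?A \<and> a \<sqsubset> b} \<longleftrightarrow> well_ordered ?A" if "?A \<subseteq> E"
  proof
    assume "wf {(a, b). a \<in> ?A \<and> b \<in> ?A \<and> a \<sqsubset> b}"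
    then show "well_ordered ?A"
      unfolding well_ordered_def wf_eq_minimal
      using that by (smt (verit, best) case_prodI equals0I mem_Collect_eq subsetD)
  qed (rule wf_lt_on)
  ultimately show ?thesis
    by (auto simp: mn_series_def well_ordered_def)
qed

lemma well_ordered_subset: "well_ordered A \<Longrightarrow> B \<subseteq> A \<Longrightarrow> well_ordered B"
  unfolding well_ordered_def by (meson subset_trans)

lemma well_ordered_Un:
  assumes "well_ordered A" "well_ordered B"
  shows "well_ordered (A \<union> B)"
  unfolding well_ordered_def
proof (intro conjI allI impI)
  show "A \<union> B \<subseteq> E" using assms by (auto simp: well_ordered_def)
  fix C assume C: "C \<subseteq> A \<union> B" "C \<noteq> {}"
  show "\<exists>b\<in>C. \<forall>c\<in>C. \<not> c \<sqsubset> b"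
  proof (cases "C \<inter> A = {} \<or> C \<inter> B = {}")
    case True
    then have "C \<subseteq> A \<or> C \<subseteq> B" using C by auto
    then show ?thesis using assms C unfolding well_ordered_def by meson
  next
    case False
    obtain a where a: "a \<in> C \<inter> A" "\<And>c. c \<in> C \<inter> A \<Longrightarrow> \<not> c \<sqsubset> a"
      using well_orderedD[OF assms(1), of "C \<inter> A"] False by auto
    obtain b where b: "b \<in> C \<inter> B" "\<And>c. c \<in> C \<inter> B \<Longrightarrow> \<not> c \<sqsubset> b"
      using well_orderedD[OF assms(2), of "C \<inter> B"] False by auto
    show ?thesis
    proof (cases "b \<sqsubset> a")
      case True
      then have "\<forall>c\<in>C. \<not> c \<sqsubset> b" using a b C lt_trans by blast
      then show ?thesis using b by auto
    next
      case False
      moreover have "a \<in> E" "b \<in> E" using a b assms by (auto simp: well_ordered_def)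
      ultimately have "a = b \<or> a \<sqsubset> b" using lt_total by blast
      then have "\<forall>c\<in>C. \<not> c \<sqsubset> a" using a b C lt_trans by blast
      then show ?thesis using a by auto
    qed
  qed
qed

lemma well_ordered_finite: "finite A \<Longrightarrow> A \<subseteq> E \<Longrightarrow> well_ordered A"
proof (induction A rule: finite_induct)
  case empty
  then show ?case by (simp add: well_ordered_def)
next
  case (insert x A)
  have "well_ordered {x}"
    using insert lt_irrefl by (auto simp: well_ordered_def subset_singleton_iff)
  then show ?case using insert well_ordered_Un[of "{x}" A] by simp
qed

text \<open>If \<open>a + b \<sqsubset> a' + b'\<close> then \<open>a \<sqsubset> a'\<close> or \<open>b \<sqsubset> b'\<close>, so the pairs are well-founded by Ramsey's
  theorem.\<close>

lemma well_ordered_sumset: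
  assumes A: "well_ordered A" and B: "well_ordered B"
  shows "well_ordered {a + b |a b. a \<in> A \<and> b \<in> B}"
proof -
  define R where "R = {((a, b), (a', b')). a \<in> A \<and> b \<in> B \<and> a' \<in> A \<and> b' \<in> B \<and> a + b \<sqsubset> a' + b'}"
  define R1 where "R1 = inv_image {(a, a'). a \<in> A \<and> a' \<in> A \<and> a \<sqsubset> a'} (fst :: expvec \<times> expvec \<Rightarrow> expvec)"
  define R2 where "R2 = inv_image {(b, b'). b \<in> B \<and> b' \<in> B \<and> b \<sqsubset> b'} (snd :: expvec \<times> expvec \<Rightarrow> expvec)"
  have wf12: "wf R1" "wf R2"
    unfolding R1_def R2_def using wf_lt_on A B by (blast intro: wf_inv_image)+
  have E: "A \<subseteq> E" "B \<subseteq> E" using A B by (auto simp: well_ordered_def)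
  have "trans R"
    by (rule transI) (auto simp: R_def intro: lt_trans)
  moreover have "R \<subseteq> R1 \<union> R2"
  proof
    fix x assume "x \<in> R"
    then obtain a b a' b' where x: "x = ((a, b), (a', b'))" "a \<in> A" "b \<in> B" "a' \<in> A" "b' \<in> B" "a + b \<sqsubset> a' + b'"
      by (auto simp: R_def)
    have "a \<sqsubset> a' \<or> b \<sqsubset> b'"
    proof (rule ccontr)
      assume "\<not> ?thesis"
      then have "a' = a \<or> a' \<sqsubset> a" "b' = b \<or> b' \<sqsubset> b" using x E lt_total by blast+
      then have "a' + b' = a + b \<or> a' + b' \<sqsubset> a + b"
        using lt_add_mono[of a' a b' b] lt_add[of a' a b] lt_add[of b' b a] x E
        by (auto simp: add.commute)
      then show False using x lt_asym lt_irrefl by metis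
    qed
    then show "x \<in> R1 \<union> R2" using x by (auto simp: R1_def R2_def)
  qed
  \<comment> \<open>A transitive relation covered by finitely many well-founded ones is
    well-founded; here two relations, numbered 0 and 1, form the cover.\<close>
  then have "disj_wf R"
    unfolding disj_wf using wf12
    by (intro exI[of _ "\<lambda>i::nat. if i = 0 then R1 else R2"] exI[of _ "2::nat"]) (auto simp: less_2_cases_iff)
  ultimately have wf: "wf R" by (rule trans_disj_wf_implies_wf)
  show ?thesis
    unfolding well_ordered_def
  proof (intro conjI allI impI)
    show "{a + b |a b. a \<in> A \<and> b \<in> B} \<subseteq> E" using E add_in_expvecs by blast
    fix C assume C: "C \<subseteq> {a + b |a b. a \<in> A \<and> b \<in> B}" "C \<noteq> {}"
    let ?Q = "{(a, b). a \<in> A \<and> b \<in> B \<and> a + b \<in> C}"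
    obtain p where "p \<in> ?Q" using C by blast
    then obtain z where z: "z \<in> ?Q" "\<And>y. (y, z) \<in> R \<Longrightarrow> y \<notin> ?Q"
      using wf unfolding wf_eq_minimal by meson
    obtain a b where ab: "z = (a, b)" by fastforce
    have "\<not> c \<sqsubset> a + b" if "c \<in> C" for c
    proof
      assume "c \<sqsubset> a + b"
      have "c \<in> {a + b |a b. a \<in> A \<and> b \<in> B}" using that C by blast
      then obtain a' b' where "c = a' + b'" "a' \<in> A" "b' \<in> B" by blast
      then show False using z(2)[of "(a', b')"] z(1) \<open>c \<sqsubset> a + b\<close> that by (auto simp: R_def ab)
    qed
    then show "\<exists>b\<in>C. \<forall>c\<in>C. \<not> c \<sqsubset> b" using z(1) ab by auto
  qed
qed

section \<open>Sums of series and uniqueness of quotients\<close>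

lemma mn_series_add:
  assumes "S \<in> mn_series V \<rho>" "T \<in> mn_series V \<rho>"
  shows "(\<lambda>a. S a + T a) \<in> mn_series V \<rho>"
proof -
  have "supp (\<lambda>a. S a + T a) \<subseteq> supp S \<union> supp T" by (auto simp: supp_def)
  then show ?thesis
    using assms well_ordered_Un well_ordered_subset unfolding mn_series_iff by blast
qed

lemma mn_series_diff:
  assumes "S \<in> mn_series V \<rho>" "T \<in> mn_series V \<rho>"
  shows "(\<lambda>a. S a - T a) \<in> mn_series V \<rho>"
proof -
  have "supp (\<lambda>a. S a - T a) \<subseteq> supp S \<union> supp T" by (auto simp: supp_def)
  then show ?thesis
    using assms well_ordered_Un well_ordered_subset unfolding mn_series_iff by blast
qed

lemma leading_key:
  assumes "P \<noteq> 0" "keys P \<subseteq> E"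
  obtains m where "m \<in> keys P" "\<And>b. b \<in> keys P \<Longrightarrow> b = m \<or> m \<sqsubset> b"
proof -
  have "keys P \<noteq> {}" using assms(1) by auto
  then obtain m where m: "m \<in> keys P" "\<And>c. c \<in> keys P \<Longrightarrow> \<not> c \<sqsubset> m"
    using well_orderedD[OF well_ordered_finite[OF finite_keys assms(2)], of "keys P"] by auto
  then have "b = m \<or> m \<sqsubset> b" if "b \<in> keys P" for b
    using assms(2) lt_total[of b m] that by blast
  with m(1) show ?thesis by (rule that)
qed

text \<open>With \<open>m\<close> and \<open>s\<close> the lowest exponents of \<open>P\<close> and
  \<open>S\<close>, only the pair (m, s) contributes to the coefficient at \<open>m + s\<close>: a
  key \<open>b\<close> above \<open>m\<close> would have to meet an exponent of \<open>S\<close>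
  below \<open>s\<close>.\<close>

lemma act_eq_zero:
  assumes S: "S \<in> mn_series V \<rho>" and P: "P \<noteq> 0" "keys P \<subseteq> E" and "act P S = (\<lambda>a. 0)"
  shows "S = (\<lambda>a. 0)"
proof (rule ccontr)
  assume "S \<noteq> (\<lambda>a. 0)"
  then have ne: "supp S \<noteq> {}" by (auto simp: supp_def)
  have SE: "supp S \<subseteq> E" using S by (simp add: mn_series_def)
  obtain s where s: "s \<in> supp S" "\<And>c. c \<in> supp S \<Longrightarrow> \<not> c \<sqsubset> s"
    using well_orderedD[of "supp S" "supp S"] S ne unfolding mn_series_iff by auto
  obtain m where m: "m \<in> keys P" "\<And>b. b \<in> keys P \<Longrightarrow> b = m \<or> m \<sqsubset> b"
    using leading_key[OF P] by blast
  have "lookup P b * S (m + s - b) = 0" if "b \<in> keys P" "b \<noteq> m" for b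
  proof -
    have bE: "m \<in> E" "b \<in> E" "s \<in> E" using m that P s SE by auto
    have "0 \<sqsubset> b - m" using m that lt_iff_diff_pos bE by blast
    then have "m + s - b \<sqsubset> s" using lt_iff_diff_pos[of "m + s - b" s] bE
      by (simp add: add_in_expvecs diff_in_expvecs)
    then show ?thesis using s(2)[of "m + s - b"] by (auto simp: supp_def)
  qed
  then have "act P S (m + s) = (\<Sum>b\<in>keys P. if b = m then lookup P m * S s else 0)"
    unfolding act_def by (intro sum.cong) auto
  then have "act P S (m + s) = lookup P m * S s" using m by simp
  then show False using assms(4) m s by (auto simp: in_keys_iff supp_def)
qed

lemma act_cancel:
  assumes "S \<in> mn_series V \<rho>" "T \<in> mn_series V \<rho>" "P \<noteq> 0" "keys P \<subseteq> E" "act P S = act P T"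
  shows "S = T"
  using act_eq_zero[OF mn_series_diff[OF assms(1,2)] assms(3,4)] assms(5)
  by (simp add: act_diff_right fun_eq_iff)

section \<open>Existence of quotients\<close>

fun multiples_sum :: "expvec list \<Rightarrow> expvec set" where
  "multiples_sum [] = {0}"
| "multiples_sum (g # gs) = {a + b |a b. a \<in> multiples_sum gs \<and> b \<in> range (\<lambda>n. scale n g)}"

text \<open>The multiples increase with \<open>n\<close>, so the least index occurring in a subset
  yields its least element.\<close>

lemma well_ordered_multiples:
  assumes "0 \<sqsubset> g"
  shows "well_ordered (range (\<lambda>n::nat. scale n g))"
proof -
  have E: "scale n g \<in> E" for n
    using lt_dom[OF assms] by (induction n) (auto intro: add_in_expvecs)
  have mono: "scale n g = scale (n + k) g \<or> scale n g \<sqsubset> scale (n + k) g" for n k :: nat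
  proof (induction k)
    case (Suc k)
    have "scale (n + k) g \<sqsubset> scale (n + Suc k) g"
      using lt_add[OF assms E[of "n + k"]] by (simp add: add.commute)
    then show ?case using Suc lt_trans by metis
  qed simp
  show ?thesis
    unfolding well_ordered_def
  proof (intro conjI allI impI)
    show "range (\<lambda>n::nat. scale n g) \<subseteq> E" using E by auto
    fix B assume B: "B \<subseteq> range (\<lambda>n::nat. scale n g)" "B \<noteq> {}"
    define n where "n = (LEAST n::nat. scale n g \<in> B)"
    have n: "scale n g \<in> B"
      unfolding n_def using B by (metis (mono_tags, lifting) LeastI equals0I imageE subsetD)
    have "\<not> c \<sqsubset> scale n g" if c: "c \<in> B" for c
    proof -
      obtain m where m: "c = scale m g" using c B by blast
      have "n \<le> m" unfolding n_def using c m by (auto intro: Least_le)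
      then obtain k where k: "m = n + k" using le_Suc_ex by blast
      show ?thesis using mono[of n k] lt_asym lt_irrefl unfolding m k by metis
    qed
    then show "\<exists>b\<in>B. \<forall>c\<in>B. \<not> c \<sqsubset> b" using n by blast
  qed
qed

text \<open>\<open>multiples_sum gs\<close> is the monoid generated by \<open>gs\<close>, written as
  an iterated sumset so that the result on sumsets applies once per generator. Denominators have
  finitely many terms, so finitely generated monoids suffice.\<close>

lemma well_ordered_multiples_sum:
  "(\<And>g. g \<in> set gs \<Longrightarrow> 0 \<sqsubset> g) \<Longrightarrow> well_ordered (multiples_sum gs)"
  by (induction gs)
    (simp_all add: well_ordered_finite zero_in_expvecs well_ordered_sumset well_ordered_multiples)

lemma zero_in_multiples_sum: "0 \<in> multiples_sum gs"
proof (induction gs)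
  case (Cons g gs)
  have "(0::expvec) = 0 + scale 0 g" by simp
  then show ?case unfolding multiples_sum.simps using Cons by blast
qed simp

lemma add_in_multiples_sum: "a \<in> multiples_sum gs \<Longrightarrow> g \<in> set gs \<Longrightarrow> a + g \<in> multiples_sum gs"
proof (induction gs arbitrary: a)
  case (Cons x gs)
  then obtain b n where a: "a = b + scale n x" "b \<in> multiples_sum gs" by auto
  show ?case
  proof (cases "g = x")
    case True
    then have "a + g = b + scale (Suc n) x" using a by (simp add: algebra_simps)
    then show ?thesis unfolding multiples_sum.simps using a(2) by blast
  next
    case False
    then have "b + g \<in> multiples_sum gs" using Cons a by auto
    moreover have "a + g = (b + g) + scale n x" using a by (simp add: algebra_simps)
    ultimately show ?thesis unfolding multiples_sum.simps by blast
  qed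
qed simp

text \<open>Carries a condition on exponents, such as the sign of one coordinate, from the numerator
  to the whole support of a quotient.\<close>

lemma multiples_sum_subset:
  assumes "a \<in> multiples_sum gs" "u \<in> U" "\<And>a g. a \<in> U \<Longrightarrow> g \<in> set gs \<Longrightarrow> a + g \<in> U"
  shows "u + a \<in> U"
  using assms
proof (induction gs arbitrary: a)
  case (Cons x gs)
  then obtain b n where a: "a = b + scale n x" "b \<in> multiples_sum gs" by auto
  have "u + b \<in> U" using Cons a by auto
  then have "u + b + scale n x \<in> U"
  proof (induction n)
    case (Suc n)
    then show ?case using Cons.prems(3)[of "u + b + scale n x" x] by (simp add: algebra_simps)
  qed simp
  then show ?case using a by (simp add: algebra_simps)
qed simp

text \<open>The coefficients of \<open>P / (1 - h)\<close> satisfy the recursion \<open>S a = P a + (\<Sum>g. h g * S (a - g))\<close>, which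
  is well-founded on the set of exponents reachable from those of \<open>P\<close>.\<close>

lemma inverse_one_minus:
  fixes P h :: "'k::field lpoly"
  assumes P: "keys P \<subseteq> E" and h: "\<And>g. g \<in> keys h \<Longrightarrow> 0 \<sqsubset> g"
    and U: "keys P \<subseteq> U" "\<And>a g. a \<in> U \<Longrightarrow> g \<in> keys h \<Longrightarrow> a + g \<in> U"
  obtains S where "S \<in> mn_series V \<rho>" "act (1 - h) S = lookup P" "supp S \<subseteq> U"
proof -
  obtain gs where gs: "set gs = keys h" using finite_list[OF finite_keys[of h]] by blast
  define W where "W = {a + b |a b. a \<in> keys P \<and> b \<in> multiples_sum gs}"
  have wo: "well_ordered W"
    unfolding W_def using h gs P
    by (intro well_ordered_sumset well_ordered_finite well_ordered_multiples_sum) auto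
  have PW: "keys P \<subseteq> W" unfolding W_def using zero_in_multiples_sum by force
  have Wadd: "a + g \<in> W" if "a \<in> W" "g \<in> keys h" for a g
  proof -
    obtain b c where "a = b + c" "b \<in> keys P" "c \<in> multiples_sum gs" using \<open>a \<in> W\<close> unfolding W_def by blast
    moreover have "c + g \<in> multiples_sum gs" using add_in_multiples_sum[of c gs g] calculation that gs by simp
    ultimately show ?thesis unfolding W_def by (metis (mono_tags, lifting) add.assoc mem_Collect_eq)
  qed
  have WU: "W \<subseteq> U"
    unfolding W_def using multiples_sum_subset[of _ gs _ U] U gs by auto
  define R where "R = {(a, b). a \<in> W \<and> b \<in> W \<and> a \<sqsubset> b}"
  have wf: "wf R" unfolding R_def by (rule wf_lt_on[OF wo])
  \<comment> \<open>The inner test cuts off calls outside \<open>W\<close>, so every call made goes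
    down along \<open>R\<close>.\<close>
  define F where "F = (\<lambda>f a. if a \<in> W then lookup P a +
    (\<Sum>g\<in>keys h. lookup h g * (if a - g \<in> W then f (a - g) else 0)) else (0::'k))"
  define S where "S = wfrec R F"
  have inR: "(a - g, a) \<in> R" if "a \<in> W" "a - g \<in> W" "g \<in> keys h" for a g
    using that wo h[of g] lt_iff_diff_pos[of "a - g" a] by (auto simp: R_def well_ordered_def subset_iff)
  have S: "S a = F S a" for a
  proof -
    have "S a = F (cut S R a) a"
      unfolding S_def by (rule wfrec[OF wf])
    also have "\<dots> = F S a"
      unfolding F_def by (auto simp: cut_apply inR intro!: sum.cong)
    finally show ?thesis .
  qed
  have out: "S a = 0" if "a \<notin> W" for a using S[of a] that by (simp add: F_def)
  have rec: "S a = lookup P a + (\<Sum>g\<in>keys h. lookup h g * S (a - g))" for a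
  proof (cases "a \<in> W")
    case True
    have "(if a - g \<in> W then S (a - g) else 0) = S (a - g)" for g using out by simp
    then show ?thesis using S[of a] True by (simp add: F_def)
  next
    case False
    then have "lookup P a = 0" using PW by (auto simp: in_keys_iff)
    \<comment> \<open>\<open>W\<close> is closed under adding keys of \<open>h\<close>, so a point
      outside \<open>W\<close> has no predecessor in \<open>W\<close> and both sides of the
      recursion vanish there.\<close>
    moreover have "a - g \<notin> W" if "g \<in> keys h" for g using Wadd[of "a - g" g] that False by auto
    then have "lookup h g * S (a - g) = 0" if "g \<in> keys h" for g using out that by simp
    ultimately show ?thesis using out[OF False] by (simp add: sum.neutral)
  qed
  have suppW: "supp S \<subseteq> W" using out by (auto simp: supp_def)
  show ?thesis
  proof
    show "S \<in> mn_series V \<rho>" unfolding mn_series_iff using wo suppW by (rule well_ordered_subset)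
    show "act (1 - h) S = lookup P"
      by (rule ext, subst act_diff_left, subst act_one_left, subst rec) (simp add: act_def)
    show "supp S \<subseteq> U" using suppW WU by simp
  qed
qed

text \<open>Factoring out the lowest term gives Q = c x^m (1 - h). The constant term of
  \<open>h\<close> cancels, and its other exponents are differences of exponents of \<open>Q\<close>
  to the lowest one, hence positive; so 1 - h can be inverted by the recursion above.\<close>

lemma ex_quotient:
  assumes P: "keys P \<subseteq> E" and Q: "Q \<noteq> 0" "keys Q \<subseteq> E"
  obtains S where "S \<in> mn_series V \<rho>" "act Q S = lookup (P :: 'k::field lpoly)"
proof -
  obtain m where m: "m \<in> keys Q" "\<And>b. b \<in> keys Q \<Longrightarrow> b = m \<or> m \<sqsubset> b"
    using leading_key[OF Q] by blast
  define c where "c = lookup Q m"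
  have c: "c \<noteq> 0" using m by (simp add: c_def in_keys_iff)
  have mE: "m \<in> E" using m Q by auto
  define h where "h = 1 - single (- m) (inverse c) * Q"
  have shift: "lookup (single (- m) (inverse c) * R) a = inverse c * lookup R (a + m)" for R a
    by (simp flip: act_lookup add: act_single)
  have Qh: "Q = single m c * (1 - h)"
    using c by (simp add: h_def mult.assoc[symmetric] mult_single)
  have hpos: "0 \<sqsubset> g" if "g \<in> keys h" for g
  proof -
    have "g \<noteq> 0" "g + m \<in> keys Q"
      using that c by (auto simp: in_keys_iff h_def lookup_minus lookup_one when_def shift simp flip: c_def
          split: if_splits)
    then show ?thesis using m(2)[of "g + m"] mE lt_iff_diff_pos[of m "g + m"] Q by auto
  qed
  define P' where "P' = single (- m) (inverse c) * P"
  have "keys P' \<subseteq> E"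
  proof
    fix a assume "a \<in> keys P'"
    then have "a + m \<in> E" using P c by (auto simp: in_keys_iff P'_def shift)
    then show "a \<in> E" using diff_in_expvecs[OF _ mE] by fastforce
  qed
  then obtain S where S: "S \<in> mn_series V \<rho>" "act (1 - h) S = lookup P'"
    using inverse_one_minus[of P' h UNIV] hpos by auto
  have "act Q S = act (single m c) (lookup P')"
    unfolding Qh act_mult_left S ..
  also have "\<dots> = lookup P"
    using c by (simp add: act_lookup P'_def mult.assoc[symmetric] mult_single)
  finally show ?thesis using S that by blast
qed

end

subsection \<open>Laurent polynomials as rational functions\<close>

abbreviation emb :: "(nat \<Rightarrow>\<^sub>0 nat) \<Rightarrow> expvec" where
  "emb \<equiv> Poly_Mapping.map int"

abbreviation pos_part :: "expvec \<Rightarrow> (nat \<Rightarrow>\<^sub>0 nat)" where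
  "pos_part \<equiv> Poly_Mapping.map nat"

lemma lookup_emb: "lookup (emb m) v = int (lookup m v)"
  by (simp add: Poly_Mapping.map.rep_eq when_def)

lemma lookup_pos_part: "lookup (pos_part a) v = nat (lookup a v)"
  by (simp add: Poly_Mapping.map.rep_eq when_def)

lemma emb_zero: "emb 0 = 0"
  by (rule poly_mapping_eqI) (simp add: lookup_emb)

lemma emb_add: "emb (m + n) = emb m + emb n"
  by (rule poly_mapping_eqI) (simp add: lookup_emb lookup_add)

lemma emb_single: "emb (single v n) = single v (int n)"
  by (rule poly_mapping_eqI) (simp add: lookup_emb lookup_single when_def)

lemma keys_emb: "keys (emb m) = keys m"
  by (auto simp: in_keys_iff lookup_emb)

lemma pos_part_emb: "pos_part (emb m) = m"
  by (rule poly_mapping_eqI) (simp add: lookup_pos_part lookup_emb)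

lemma emb_pos_part: "(\<And>v. lookup a v \<ge> 0) \<Longrightarrow> emb (pos_part a) = a"
  by (rule poly_mapping_eqI) (simp add: lookup_pos_part lookup_emb)

lemma keys_pos_part: "keys (pos_part a) \<subseteq> keys a"
  by (auto simp: in_keys_iff lookup_pos_part)

lemma single_one_nonzero: "single a (1::'k::zero_neq_one) \<noteq> 0"
  by (metis lookup_single_eq lookup_zero zero_neq_one)

definition laurent_of :: "'k::field mpoly \<Rightarrow> 'k lpoly" where
  "laurent_of = eval_monoid_algebra (single 0) (\<lambda>m. single (emb m) 1)"

interpretation poly: monoid_algebra_eval "single 0 :: 'k::field \<Rightarrow> 'k lpoly" "\<lambda>m. single (emb m) 1"
  rewrites "eval_monoid_algebra (single 0 :: 'k::field \<Rightarrow> 'k lpoly) (\<lambda>m. single (emb m) 1) \<equiv> laurent_of"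
  by unfold_locales (simp_all add: laurent_of_def single_add mult_single emb_zero emb_add)

lemma laurent_of_single: "laurent_of (single m c) = single (emb m) c"
  by (simp add: poly.ev_single mult_single)

text \<open>Both sides are additive in \<open>p\<close>. For a monomial, nonnegativity of
  \<open>a\<close> together with positive part \<open>m\<close> says precisely that \<open>a\<close>
  is \<open>emb m\<close>.\<close>

lemma lookup_laurent_of: "lookup (laurent_of p) = series_of_poly p"
proof (induction p rule: poly_mapping_additive_induct)
  case (single m c)
  have "(\<forall>v. lookup a v \<ge> 0) \<and> m = pos_part a \<longleftrightarrow> emb m = a" for a
    using emb_pos_part[of a] pos_part_emb[of m] by (auto simp: lookup_emb)
  then have "series_of_poly (single m c) a = lookup (single (emb m) c) a" for a
    unfolding series_of_poly_def lookup_single when_def by (smt (verit, best))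
  then show ?case
    by (simp add: laurent_of_single fun_eq_iff)
qed (simp add: poly.ev_add lookup_add series_of_poly_def fun_eq_iff)

definition monomial :: "expvec \<Rightarrow> 'k::field ratfun" where
  "monomial a = Fraction_Field.Fract (single (pos_part a) 1) (single (pos_part (- a)) 1)"

lemma monomial_add: "monomial (a + b) = monomial a * (monomial b :: 'k::field ratfun)"
proof -
  \<comment> \<open>Cross multiplication of the two fractions; it holds because each vector is its
    positive part minus its negative part.\<close>
  have "pos_part (a + b) + (pos_part (- a) + pos_part (- b)) = pos_part a + pos_part b + pos_part (- (a + b))"
    by (rule poly_mapping_eqI) (simp add: lookup_pos_part lookup_add lookup_minus)
  then show ?thesis
    by (simp add: monomial_def eq_fract single_one_nonzero mult_single)
qed

lemma monomial_emb: "monomial (emb m) = Fraction_Field.Fract (single m 1) (1 :: 'k::field mpoly)"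
proof -
  have "pos_part (- emb m) = 0"
    by (rule poly_mapping_eqI) (simp add: lookup_pos_part lookup_emb)
  then show ?thesis by (simp add: monomial_def pos_part_emb)
qed

lemma monomial_zero: "monomial 0 = 1"
  using monomial_emb[of 0] by (simp add: emb_zero One_fract_def)

lemma const_ratfun_add: "const_ratfun (x + y) = const_ratfun x + const_ratfun y"
  by (simp add: const_ratfun_def single_add)

lemma const_ratfun_mult: "const_ratfun (x * y) = const_ratfun x * const_ratfun y"
  by (simp add: const_ratfun_def mult_single)

lemma const_ratfun_one: "const_ratfun 1 = 1"
  by (simp add: const_ratfun_def One_fract_def)

definition ratfun_of :: "'k::field lpoly \<Rightarrow> 'k ratfun" where
  "ratfun_of = eval_monoid_algebra const_ratfun monomial"

interpretation rat: monoid_algebra_eval "const_ratfun :: 'k::field \<Rightarrow> 'k ratfun" monomial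
  rewrites "eval_monoid_algebra (const_ratfun :: 'k::field \<Rightarrow> 'k ratfun) monomial \<equiv> ratfun_of"
  by unfold_locales
    (simp_all add: ratfun_of_def const_ratfun_add const_ratfun_mult const_ratfun_one monomial_zero monomial_add)

lemma ratfun_of_laurent_of: "ratfun_of (laurent_of p) = Fraction_Field.Fract p 1"
proof (induction p rule: poly_mapping_additive_induct)
  case (single m c)
  show ?case
    by (simp add: laurent_of_single rat.ev_single const_ratfun_def monomial_emb mult_single)
qed (simp add: poly.ev_add rat.ev_add)

definition lpolys :: "nat set \<Rightarrow> 'k::field lpoly set" where
  "lpolys V = {P. keys P \<subseteq> expvecs V}"

lemma lpolys_UNIV: "P \<in> lpolys UNIV"
  by (simp add: lpolys_def expvecs_def)

lemma lpolys_single: "a \<in> expvecs V \<Longrightarrow> single a c \<in> lpolys V"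
  by (simp add: lpolys_def)

lemma lpolys_one: "1 \<in> lpolys V"
  by (simp flip: single_one add: lpolys_single zero_in_expvecs)

lemma lpolys_zero: "0 \<in> lpolys V"
  by (simp add: lpolys_def)

lemma lpolys_add: "P \<in> lpolys V \<Longrightarrow> Q \<in> lpolys V \<Longrightarrow> P + Q \<in> lpolys V"
  using keys_add[of P Q] by (auto simp: lpolys_def)

lemma lpolys_uminus: "P \<in> lpolys V \<Longrightarrow> - P \<in> lpolys V"
  by (auto simp: lpolys_def in_keys_iff)

lemma lpolys_diff: "P \<in> lpolys V \<Longrightarrow> Q \<in> lpolys V \<Longrightarrow> P - Q \<in> lpolys V"
  using lpolys_add[of P V "- Q"] by (simp add: lpolys_uminus)

lemma lpolys_mult: "P \<in> lpolys V \<Longrightarrow> Q \<in> lpolys V \<Longrightarrow> P * Q \<in> lpolys V"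
  using keys_mult[of P Q] by (fastforce simp: lpolys_def intro: add_in_expvecs)

lemma lpolys_prod: "(\<And>i. i \<in> A \<Longrightarrow> f i \<in> lpolys V) \<Longrightarrow> prod f A \<in> lpolys V"
  by (induction A rule: infinite_finite_induct) (auto intro: lpolys_mult lpolys_one)

lemma lpolys_sum: "(\<And>i. i \<in> A \<Longrightarrow> f i \<in> lpolys V) \<Longrightarrow> sum f A \<in> lpolys V"
  by (induction A rule: infinite_finite_induct) (auto intro: lpolys_add lpolys_zero)

lemma lpolys_prod_list: "(\<And>P. P \<in> set Ps \<Longrightarrow> P \<in> lpolys V) \<Longrightarrow> prod_list Ps \<in> lpolys V"
  by (induction Ps) (auto intro: lpolys_mult lpolys_one)

lemma laurent_of_in_lpolys: "p \<in> polys V \<Longrightarrow> laurent_of p \<in> lpolys V"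
  unfolding laurent_of_def eval_monoid_algebra_def
  by (intro lpolys_sum lpolys_mult lpolys_single)
    (auto simp: polys_def expvecs_def keys_emb zero_in_expvecs)

section \<open>Clearing denominators\<close>

lemma ex_clearing_monomial:
  assumes "finite A" "A \<subseteq> expvecs V"
  obtains m where "keys m \<subseteq> V" "\<And>a v. a \<in> A \<Longrightarrow> lookup (emb m + a) v \<ge> 0"
proof
  \<comment> \<open>The sum of all negative parts dominates each of them.\<close>
  define m where "m = (\<Sum>a\<in>A. pos_part (- a))"
  show "keys m \<subseteq> V"
  proof -
    have "keys (pos_part (- a)) \<subseteq> V" if "a \<in> A" for a
      using keys_pos_part[of "- a"] that assms by (auto simp: expvecs_def)
    then show ?thesis
      unfolding m_def using keys_sum[of "\<lambda>a. pos_part (- a)" A] by blast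
  qed
  fix a v assume a: "a \<in> A"
  have "lookup (pos_part (- a)) v \<le> lookup m v"
    unfolding m_def lookup_sum using assms(1) a by (intro member_le_sum) auto
  then show "lookup (emb m + a) v \<ge> 0"
    by (simp add: lookup_add lookup_emb lookup_pos_part)
qed

lemma ex_clear_denominator:
  assumes P: "P \<in> lpolys V" and m: "keys m \<subseteq> V" "\<And>a v. a \<in> keys P \<Longrightarrow> lookup (emb m + a) v \<ge> 0"
  obtains p where "p \<in> polys V" "single (emb m) 1 * P = laurent_of p"
proof
  define p where "p = (\<Sum>a\<in>keys P. single (pos_part (emb m + a)) (lookup P a))"
  have "keys (pos_part (emb m + a)) \<subseteq> V" if "a \<in> keys P" for a
    using keys_pos_part[of "emb m + a"] keys_add[of "emb m" a] m(1) P that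
    by (fastforce simp: keys_emb lpolys_def expvecs_def)
  then show "p \<in> polys V"
    unfolding p_def polys_def using keys_sum[of "\<lambda>a. single (pos_part (emb m + a)) (lookup P a)" "keys P"]
    by (fastforce split: if_splits)
  have "laurent_of p = (\<Sum>a\<in>keys P. laurent_of (single (pos_part (emb m + a)) (lookup P a)))"
    unfolding p_def by (rule poly.ev_sum)
  also have "\<dots> = (\<Sum>a\<in>keys P. single (emb m) 1 * single a (lookup P a))"
    by (intro sum.cong) (simp_all add: laurent_of_single emb_pos_part m(2) mult_single)
  also have "\<dots> = single (emb m) 1 * P"
    unfolding sum_distrib_left[symmetric] sum_single_lookup ..
  finally show "single (emb m) 1 * P = laurent_of p" ..
qed

lemma ex_clear_denominators:
  assumes P: "P \<in> lpolys V" and Q: "Q \<in> lpolys V"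
  obtains p q m where "p \<in> polys V" "q \<in> polys V"
    "single (emb m) 1 * P = laurent_of p" "single (emb m) 1 * Q = laurent_of q"
proof -
  obtain m where m: "keys m \<subseteq> V" "\<And>a v. a \<in> keys P \<union> keys Q \<Longrightarrow> lookup (emb m + a) v \<ge> 0"
    using ex_clearing_monomial[of "keys P \<union> keys Q" V] P Q by (auto simp: lpolys_def)
  obtain p where "p \<in> polys V" "single (emb m) 1 * P = laurent_of p"
    using ex_clear_denominator[OF P m(1)] m(2) by blast
  moreover obtain q where "q \<in> polys V" "single (emb m) 1 * Q = laurent_of q"
    using ex_clear_denominator[OF Q m(1)] m(2) by blast
  ultimately show ?thesis using that by blast
qed

text \<open>Multiplication by an invertible monomial turns \<open>P\<close> into a polynomial, and
  polynomials embed into their fraction field.\<close>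

lemma ratfun_of_eq_zero_iff: "ratfun_of P = 0 \<longleftrightarrow> P = 0"
proof
  assume 0: "ratfun_of P = 0"
  obtain p q m where p: "single (emb m) 1 * P = laurent_of p"
    using ex_clear_denominators[OF lpolys_UNIV lpolys_UNIV, of P 0] by metis
  have "Fraction_Field.Fract p 1 = 0"
    using 0 by (simp flip: ratfun_of_laurent_of p add: rat.ev_mult)
  then have "p = 0" by (simp add: Zero_fract_def eq_fract)
  then show "P = 0" using p by (simp add: poly.ev_zero single_one_nonzero)
qed (simp add: rat.ev_zero)

lemma ratfun_of_eq_iff: "ratfun_of P = ratfun_of Q \<longleftrightarrow> P = Q"
  using ratfun_of_eq_zero_iff[of "P - Q"] by (simp add: rat.ev_diff)

lemma laurent_of_eq_zero_iff: "laurent_of p = 0 \<longleftrightarrow> p = 0"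
  using ratfun_of_laurent_of[of p] ratfun_of_eq_zero_iff[of "laurent_of p"]
  by (simp add: Zero_fract_def eq_fract)

lemma Fract_eq_ratfun_of:
  "q \<noteq> 0 \<Longrightarrow> Fraction_Field.Fract p q = ratfun_of (laurent_of p) / ratfun_of (laurent_of q)"
  by (simp add: ratfun_of_laurent_of)

lemma ratfunsE:
  assumes "G \<in> ratfuns V"
  obtains P Q where "P \<in> lpolys V" "Q \<in> lpolys V" "Q \<noteq> 0" "G = ratfun_of P / ratfun_of Q"
proof -
  obtain p q where pq: "p \<in> polys V" "q \<in> polys V" "q \<noteq> 0" "G = Fraction_Field.Fract p q"
    using assms unfolding ratfuns_def by blast
  show ?thesis
    by (rule that[of "laurent_of p" "laurent_of q"])
      (simp_all add: pq Fract_eq_ratfun_of laurent_of_in_lpolys laurent_of_eq_zero_iff)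
qed

text \<open>One monomial clears both \<open>P\<close> and \<open>Q\<close>, so it cancels in the
  quotient, and an equation Q S = P passes to the polynomials \<open>q\<close> and \<open>p\<close>
  of the definitions.\<close>

lemma quotient_as_Fract:
  assumes P: "P \<in> lpolys V" and Q: "Q \<in> lpolys V" "Q \<noteq> 0"
  obtains p q m where "p \<in> polys V" "q \<in> polys V" "q \<noteq> 0"
    "ratfun_of P / ratfun_of Q = Fraction_Field.Fract p q"
    "single (emb m) 1 * P = laurent_of p" "single (emb m) 1 * Q = laurent_of q"
proof -
  obtain p q m where pq: "p \<in> polys V" "q \<in> polys V"
    "single (emb m) 1 * P = laurent_of p" "single (emb m) 1 * Q = laurent_of q"
    using ex_clear_denominators[OF P Q(1)] .
  have "laurent_of q \<noteq> 0" using Q(2) by (simp flip: pq(4) add: single_one_nonzero)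
  then have q: "q \<noteq> 0" by (simp add: laurent_of_eq_zero_iff)
  have "ratfun_of (single (emb m) 1) \<noteq> (0::'a ratfun)"
    by (simp add: ratfun_of_eq_zero_iff single_one_nonzero)
  then have "ratfun_of P / ratfun_of Q = Fraction_Field.Fract p q"
    by (simp add: Fract_eq_ratfun_of[OF q] flip: pq(3,4) add: rat.ev_mult)
  then show ?thesis using that pq q by blast
qed

lemma quotient_in_ratfuns:
  assumes "P \<in> lpolys V" "Q \<in> lpolys V" "Q \<noteq> 0"
  shows "ratfun_of P / ratfun_of Q \<in> ratfuns V"
  by (rule quotient_as_Fract[OF assms]) (auto simp: ratfuns_def)

lemma quotient_add:
  assumes "Q \<noteq> 0" "Q' \<noteq> 0"
  shows "ratfun_of P / ratfun_of Q + ratfun_of P' / ratfun_of Q' =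
    ratfun_of (P * Q' + P' * Q) / ratfun_of (Q * Q')"
  using assms by (simp add: rat.ev_add rat.ev_mult ratfun_of_eq_zero_iff field_simps)

lemma ratfuns_add:
  assumes "G \<in> ratfuns V" "H \<in> ratfuns V"
  shows "G + H \<in> ratfuns V"
proof -
  obtain P Q where 1: "P \<in> lpolys V" "Q \<in> lpolys V" "Q \<noteq> 0" "G = ratfun_of P / ratfun_of Q"
    using assms(1) by (rule ratfunsE)
  obtain P' Q' where 2: "P' \<in> lpolys V" "Q' \<in> lpolys V" "Q' \<noteq> 0" "H = ratfun_of P' / ratfun_of Q'"
    using assms(2) by (rule ratfunsE)
  show ?thesis
    unfolding 1 2 quotient_add[OF 1(3) 2(3)]
    by (rule quotient_in_ratfuns) (use 1 2 in \<open>auto intro: lpolys_mult lpolys_add\<close>)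
qed

lemma quotient_cross:
  assumes "Q \<noteq> 0" "Q' \<noteq> 0" "ratfun_of P / ratfun_of Q = ratfun_of P' / ratfun_of Q'"
  shows "P * Q' = P' * Q"
  using assms by (simp add: ratfun_of_eq_zero_iff frac_eq_eq ratfun_of_eq_iff flip: rat.ev_mult)

subsection \<open>Expansions and constant terms\<close>

text \<open>A pair with sum \<open>a\<close> is determined by its first entry, which ranges over a
  finite support. Keys \<open>b\<close> with \<open>a - b\<close> outside the support of
  \<open>S\<close> add zero terms.\<close>

lemma mn_mult_series_of_poly: "mn_mult (series_of_poly q) S = act (laurent_of q) S"
proof
  fix a :: expvec
  let ?f = "\<lambda>b. (b, a - b)"
  let ?B = "{b \<in> keys (laurent_of q). a - b \<in> supp S}"
  have eq: "{(b, c). b \<in> supp (series_of_poly q) \<and> c \<in> supp S \<and> b + c = a} = ?f ` ?B"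
    by (auto simp: supp_def in_keys_iff lookup_laurent_of image_iff)
  have "mn_mult (series_of_poly q) S a = (\<Sum>b\<in>?B. series_of_poly q b * S (a - b))"
    unfolding mn_mult_def eq by (subst sum.reindex) (auto simp: inj_on_def)
  also have "\<dots> = act (laurent_of q) S a"
    unfolding act_def lookup_laurent_of by (rule sum.mono_neutral_left) (auto simp: supp_def)
  finally show "mn_mult (series_of_poly q) S a = act (laurent_of q) S a" .
qed

context compatible
begin

text \<open>The equation may be checked on any representation by Laurent polynomials. Any other
  representation is related to it by cross multiplication, so both candidate series solve one
  equation with denominator q Q, and cancellation identifies them.\<close>

lemma expansionI:
  assumes S: "S \<in> mn_series V \<rho>" and P: "P \<in> lpolys V" and Q: "Q \<in> lpolys V" "Q \<noteq> 0"
    and eq: "act Q S = lookup P"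
  shows "expansion V \<rho> (ratfun_of P / ratfun_of Q) = S"
  unfolding expansion_def
proof (rule the_equality)
  obtain p q m where pq: "p \<in> polys V" "q \<in> polys V" "q \<noteq> 0"
    "ratfun_of P / ratfun_of Q = Fraction_Field.Fract p q"
    "single (emb m) 1 * P = laurent_of p" "single (emb m) 1 * Q = laurent_of q"
    using quotient_as_Fract[OF P Q] .
  have "act (laurent_of q) S = lookup (laurent_of p)"
    unfolding pq(5,6)[symmetric] by (simp add: act_mult_left eq act_lookup)
  then have "mn_mult (series_of_poly q) S = series_of_poly p"
    by (simp add: mn_mult_series_of_poly lookup_laurent_of)
  then show "S \<in> mn_series V \<rho> \<and> (\<exists>p q. p \<in> polys V \<and> q \<in> polys V \<and> q \<noteq> 0 \<and>
      ratfun_of P / ratfun_of Q = Fraction_Field.Fract p q \<and> mn_mult (series_of_poly q) S = series_of_poly p)"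
    using S pq by blast
next
  fix S'
  assume "S' \<in> mn_series V \<rho> \<and> (\<exists>p q. p \<in> polys V \<and> q \<in> polys V \<and> q \<noteq> 0 \<and>
      ratfun_of P / ratfun_of Q = Fraction_Field.Fract p q \<and> mn_mult (series_of_poly q) S' = series_of_poly p)"
  then obtain p q where S': "S' \<in> mn_series V \<rho>" and pq: "p \<in> polys V" "q \<in> polys V" "q \<noteq> 0"
    "ratfun_of P / ratfun_of Q = Fraction_Field.Fract p q" "act (laurent_of q) S' = lookup (laurent_of p)"
    unfolding mn_mult_series_of_poly lookup_laurent_of by blast
  have q0: "laurent_of q \<noteq> 0" using pq by (simp add: laurent_of_eq_zero_iff)
  have cross: "P * laurent_of q = laurent_of p * Q"
    using quotient_cross[OF Q(2) q0] pq(4) unfolding Fract_eq_ratfun_of[OF pq(3)] .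
  show "S' = S"
  proof (rule act_cancel[OF S' S])
    show "laurent_of q * Q \<noteq> 0" using q0 Q by simp
    show "keys (laurent_of q * Q) \<subseteq> E"
      using lpolys_mult[OF laurent_of_in_lpolys[OF pq(2)] Q(1)] by (simp add: lpolys_def)
    have "act (laurent_of q * Q) S' = lookup (Q * laurent_of p)"
      by (subst mult.commute) (simp add: act_mult_left pq(5) act_lookup)
    also have "Q * laurent_of p = laurent_of q * P"
      using cross by (simp add: mult.commute)
    also have "lookup \<dots> = act (laurent_of q * Q) S"
      by (simp add: act_mult_left eq act_lookup)
    finally show "act (laurent_of q * Q) S' = act (laurent_of q * Q) S" .
  qed
qed

lemma expansionD:
  assumes P: "P \<in> lpolys V" and Q: "Q \<in> lpolys V" "Q \<noteq> 0"
  shows "expansion V \<rho> (ratfun_of P / ratfun_of Q) \<in> mn_series V \<rho>"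
    and "act Q (expansion V \<rho> (ratfun_of P / ratfun_of Q)) = lookup P"
proof -
  obtain S where "S \<in> mn_series V \<rho>" "act Q S = lookup P"
    using ex_quotient[of P Q] P Q by (auto simp: lpolys_def)
  then show "expansion V \<rho> (ratfun_of P / ratfun_of Q) \<in> mn_series V \<rho>"
    and "act Q (expansion V \<rho> (ratfun_of P / ratfun_of Q)) = lookup P"
    using expansionI[OF _ P Q] by simp_all
qed

lemma expansion_add:
  assumes "G \<in> ratfuns V" "H \<in> ratfuns V"
  shows "expansion V \<rho> (G + H) = (\<lambda>a. expansion V \<rho> G a + expansion V \<rho> H a)"
proof -
  obtain P Q where 1: "P \<in> lpolys V" "Q \<in> lpolys V" "Q \<noteq> 0" "G = ratfun_of P / ratfun_of Q"
    using assms(1) by (rule ratfunsE)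
  obtain P' Q' where 2: "P' \<in> lpolys V" "Q' \<in> lpolys V" "Q' \<noteq> 0" "H = ratfun_of P' / ratfun_of Q'"
    using assms(2) by (rule ratfunsE)
  note G = expansionD[OF 1(1-3), folded 1(4)] and H = expansionD[OF 2(1-3), folded 2(4)]
  have "act (Q * Q') (\<lambda>a. expansion V \<rho> G a + expansion V \<rho> H a) = lookup (P * Q' + P' * Q)"
  proof -
    have "act (Q * Q') (expansion V \<rho> G) = lookup (P * Q')"
      by (subst mult.commute) (simp add: act_mult_left G act_lookup mult.commute)
    moreover have "act (Q * Q') (expansion V \<rho> H) = lookup (P' * Q)"
      by (simp add: act_mult_left H act_lookup mult.commute[of P'])
    ultimately show ?thesis by (simp add: act_add_right lookup_add fun_eq_iff)
  qed
  moreover have "G + H = ratfun_of (P * Q' + P' * Q) / ratfun_of (Q * Q')"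
    unfolding 1 2 by (rule quotient_add[OF 1(3) 2(3)])
  ultimately show ?thesis
    using expansionI[OF mn_series_add[OF G(1) H(1)], of "P * Q' + P' * Q" "Q * Q'"] 1 2
    by (simp add: lpolys_add lpolys_mult)
qed

text \<open>A common expansion S gives Q' P = Q' Q S = Q P', which is equality of the
  fractions.\<close>

lemma expansion_inject:
  assumes "G \<in> ratfuns V" "H \<in> ratfuns V" "expansion V \<rho> G = expansion V \<rho> H"
  shows "G = H"
proof -
  obtain P Q where 1: "P \<in> lpolys V" "Q \<in> lpolys V" "Q \<noteq> 0" "G = ratfun_of P / ratfun_of Q"
    using assms(1) by (rule ratfunsE)
  obtain P' Q' where 2: "P' \<in> lpolys V" "Q' \<in> lpolys V" "Q' \<noteq> 0" "H = ratfun_of P' / ratfun_of Q'"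
    using assms(2) by (rule ratfunsE)
  note G = expansionD[OF 1(1-3), folded 1(4)] and H = expansionD[OF 2(1-3), folded 2(4)]
  have "lookup (Q' * P) = act (Q' * Q) (expansion V \<rho> G)"
    by (simp add: act_mult_left G act_lookup)
  also have "\<dots> = act (Q * Q') (expansion V \<rho> H)"
    by (simp add: assms(3) mult.commute)
  also have "\<dots> = lookup (Q * P')"
    by (simp add: act_mult_left H act_lookup)
  finally have "Q' * P = Q * P'" by (simp add: Poly_Mapping.lookup_inject)
  then have "ratfun_of Q' * ratfun_of P = ratfun_of Q * ratfun_of P'"
    by (simp flip: rat.ev_mult)
  then show ?thesis
    using 1(3) 2(3) by (simp add: 1(4) 2(4) ratfun_of_eq_zero_iff field_simps)
qed

text \<open>Relational form of \<open>CT\<close>: it includes the existence of the constant term,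
  which must be known before the definite description can be evaluated.\<close>

definition is_CT :: "nat \<Rightarrow> 'k::field ratfun \<Rightarrow> 'k ratfun \<Rightarrow> bool" where
  "is_CT j G R \<longleftrightarrow> G \<in> ratfuns V \<and> R \<in> ratfuns V \<and>
    expansion V \<rho> R = series_CT j (expansion V \<rho> G)"

lemma CT_eq: "is_CT j G R \<Longrightarrow> CT V \<rho> j G = R"
  unfolding CT_def is_CT_def by (rule the_equality) (auto intro: expansion_inject)

lemma is_CT_add:
  assumes "is_CT j G R" "is_CT j G' R'"
  shows "is_CT j (G + G') (R + R')"
  using assms unfolding is_CT_def
  by (auto simp: ratfuns_add expansion_add series_CT_def fun_eq_iff)

end

subsection \<open>Constant terms at zero and at infinity\<close>

text \<open>The sign \<open>\<sigma>\<close> is \<open>1\<close> for the expansion at zero and \<open>-1\<close> for the expansion at infinity: the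
  variable \<open>j\<close> becomes the power \<open>\<sigma>\<close> of the indeterminate.\<close>

definition laurent_monomial :: "int \<Rightarrow> nat \<Rightarrow> expvec \<Rightarrow> 'k::field ratfun fls" where
  "laurent_monomial \<sigma> j a =
    fls_const (monomial (a - single j (lookup a j))) * fls_X_intpow (\<sigma> * lookup a j)"

definition laurent_at :: "int \<Rightarrow> nat \<Rightarrow> 'k::field lpoly \<Rightarrow> 'k ratfun fls" where
  "laurent_at \<sigma> j = eval_monoid_algebra (\<lambda>c. fls_const (const_ratfun c)) (laurent_monomial \<sigma> j)"

lemma laurent_monomial_zero: "laurent_monomial \<sigma> j 0 = 1"
  by (simp add: laurent_monomial_def monomial_zero)

lemma laurent_monomial_add:
  "laurent_monomial \<sigma> j (a + b) = laurent_monomial \<sigma> j a * (laurent_monomial \<sigma> j b :: 'k::field ratfun fls)"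
proof -
  have "a + b - single j (lookup (a + b) j) = (a - single j (lookup a j)) + (b - single j (lookup b j))"
    by (simp add: lookup_add single_add)
  moreover have "fls_X_intpow (\<sigma> * lookup (a + b) j) =
      (fls_X_intpow (\<sigma> * lookup a j) * fls_X_intpow (\<sigma> * lookup b j) :: 'k ratfun fls)"
    by (simp add: fls_X_intpow_times_fls_X_intpow lookup_add algebra_simps)
  ultimately show ?thesis
    unfolding laurent_monomial_def by (simp only: monomial_add fls_const_mult_const[symmetric] mult_ac)
qed

interpretation laurent:
  monoid_algebra_eval "\<lambda>c::'k::field. fls_const (const_ratfun c)" "laurent_monomial \<sigma> j"
  rewrites "eval_monoid_algebra (\<lambda>c::'k::field. fls_const (const_ratfun c)) (laurent_monomial \<sigma> j) \<equiv> laurent_at \<sigma> j"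
  for \<sigma> j
  by unfold_locales
    (simp_all add: laurent_at_def const_ratfun_add const_ratfun_mult const_ratfun_one fls_plus_const
      laurent_monomial_zero laurent_monomial_add)

lemma laurent_at_nth:
  "fls_nth (laurent_at \<sigma> j P) n = (\<Sum>a\<in>keys P. if \<sigma> * lookup a j = n
    then const_ratfun (lookup P a) * monomial (a - single j (lookup a j)) else 0)"
  unfolding laurent_at_def eval_monoid_algebra_def fls_nth_sum
  by (intro sum.cong) (auto simp: laurent_monomial_def mult.assoc[symmetric] fls_X_intpow_times_conv_shift)

text \<open>As \<open>\<sigma>\<close> is nonzero, each Laurent coefficient comes from a single
  slice of \<open>P\<close> with fixed \<open>j\<close>-exponent. The slices, multiplied by powers
  of the variable \<open>j\<close>, add up to \<open>ratfun_of P\<close>, which is injective in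
  \<open>P\<close>.\<close>

lemma laurent_at_eq_zero_iff:
  assumes "\<sigma> \<noteq> 0"
  shows "laurent_at \<sigma> j P = 0 \<longleftrightarrow> P = 0"
proof
  assume 0: "laurent_at \<sigma> j P = 0"
  let ?t = "\<lambda>a. const_ratfun (lookup P a) * monomial (a - single j (lookup a j))"
  have slice: "(\<Sum>a\<in>{a\<in>keys P. lookup a j = k}. ?t a) = 0" for k
  proof -
    have "(\<Sum>a\<in>{a\<in>keys P. lookup a j = k}. ?t a) = fls_nth (laurent_at \<sigma> j P) (\<sigma> * k)"
      unfolding laurent_at_nth by (rule sum.mono_neutral_cong_left) (use assms in auto)
    then show ?thesis by (simp add: 0)
  qed
  have mon: "monomial a = monomial (a - single j (lookup a j)) * (monomial (single j (lookup a j)) :: 'a ratfun)" for a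
    by (simp flip: monomial_add)
  have "ratfun_of P = (\<Sum>a\<in>keys P. ?t a * monomial (single j (lookup a j)))"
    unfolding ratfun_of_def eval_monoid_algebra_def by (subst mon) (simp add: mult.assoc)
  also have "\<dots> = (\<Sum>k\<in>(\<lambda>a. lookup a j) ` keys P.
      \<Sum>a\<in>{a\<in>keys P. lookup a j = k}. ?t a * monomial (single j (lookup a j)))"
    by (rule sum.image_gen) simp
  also have "\<dots> = (\<Sum>k\<in>(\<lambda>a. lookup a j) ` keys P.
      (\<Sum>a\<in>{a\<in>keys P. lookup a j = k}. ?t a) * monomial (single j k))"
    unfolding sum_distrib_right by (intro sum.cong) auto
  also have "\<dots> = 0" unfolding slice by simp
  finally show "P = 0" by (simp add: ratfun_of_eq_zero_iff)
qed (simp add: laurent.ev_zero)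

lemma monomial_single: "monomial (single v (int n)) = (var_ratfun v :: 'k::field ratfun) ^ n"
proof (induction n)
  case (Suc n)
  have "single v (int (Suc n)) = emb (single v 1) + single v (int n)"
    by (simp add: emb_single flip: single_add)
  then show ?case
    using Suc by (simp only: monomial_add monomial_emb var_ratfun_def power_Suc)
qed (simp add: monomial_zero)

text \<open>Both sides turn sums of exponent vectors into products, so it is enough to compare
  powers of a single variable.\<close>

lemma prod_keys_eq_laurent_monomial:
  "(\<Prod>v\<in>keys m. (if v = j then fls_X_intpow \<sigma> else fls_const (var_ratfun v)) ^ lookup m v) =
    (laurent_monomial \<sigma> j (emb m) :: 'k::field ratfun fls)"
proof -
  let ?f = "\<lambda>v. if v = j then fls_X_intpow \<sigma> else (fls_const (var_ratfun v) :: 'k ratfun fls)"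
  define \<nu> where "\<nu> m = (\<Prod>v\<in>keys m. ?f v ^ lookup m v)" for m
  have superset: "\<nu> m = (\<Prod>v\<in>A. ?f v ^ lookup m v)" if "finite A" "keys m \<subseteq> A" for m A
    unfolding \<nu>_def by (rule prod.mono_neutral_left) (use that in \<open>auto simp: in_keys_iff\<close>)
  have add: "\<nu> (m + n) = \<nu> m * \<nu> n" for m n
    using superset[of "keys m \<union> keys n" m] superset[of "keys m \<union> keys n" n]
      superset[of "keys m \<union> keys n" "m + n"] keys_add[of m n]
    by (simp add: lookup_add power_add prod.distrib)
  have single: "\<nu> (single v n) = laurent_monomial \<sigma> j (emb (single v n))" for v n
  proof -
    have "\<nu> (single v n) = ?f v ^ n"
      using superset[of "{v}" "single v n"] by (cases "n = 0") simp_all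
    also have "\<dots> = laurent_monomial \<sigma> j (emb (single v n))"
      by (simp add: laurent_monomial_def emb_single lookup_single when_def monomial_zero fls_X_intpow_power
          monomial_single fls_const_power mult.commute)
    finally show ?thesis .
  qed
  have "\<nu> m = laurent_monomial \<sigma> j (emb m)"
    by (induction m rule: poly_mapping_additive_induct)
      (simp_all only: single add emb_add laurent_monomial_add)
  then show ?thesis by (simp add: \<nu>_def)
qed

lemma laurent_of_poly_eq: "laurent_of_poly j (fls_X_intpow \<sigma>) p = laurent_at \<sigma> j (laurent_of p)"
proof -
  have "laurent_of_poly j (fls_X_intpow \<sigma>) p =
      (\<Sum>m\<in>keys p. fls_const (const_ratfun (lookup p m)) * laurent_monomial \<sigma> j (emb m))"
    unfolding laurent_of_poly_def prod_keys_eq_laurent_monomial ..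
  also have "\<dots> = laurent_at \<sigma> j (laurent_of p)"
  proof (induction p rule: poly_mapping_additive_induct)
    case (single m c)
    show ?case
      by (cases "c = 0") (simp_all add: laurent_of_single laurent.ev_single laurent.ev_zero poly.ev_zero)
  next
    case (add p q)
    then show ?case
      using sum_keys_add[of "\<lambda>m c. fls_const (const_ratfun c) * laurent_monomial \<sigma> j (emb m)" p q]
      by (simp add: poly.ev_add laurent.ev_add laurent.c_zero laurent.c_add algebra_simps)
  qed
  finally show ?thesis .
qed

text \<open>Two representations of a rational function agree after cross multiplication, and this
  survives the homomorphism \<open>laurent_at\<close>; so the definite description has one candidate
  only.\<close>

lemma laurent_expansion_eq:
  assumes "\<sigma> \<noteq> 0" "Q \<noteq> 0"
  shows "laurent_expansion j (fls_X_intpow \<sigma>) (ratfun_of P / ratfun_of Q) =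
    laurent_at \<sigma> j P / laurent_at \<sigma> j Q"
proof -
  have eq: "laurent_at \<sigma> j (laurent_of p) / laurent_at \<sigma> j (laurent_of q) = laurent_at \<sigma> j P / laurent_at \<sigma> j Q"
    if "q \<noteq> 0" "ratfun_of P / ratfun_of Q = Fraction_Field.Fract p q" for p q
  proof -
    have "P * laurent_of q = laurent_of p * Q"
      by (rule quotient_cross) (use that assms in \<open>simp_all add: Fract_eq_ratfun_of laurent_of_eq_zero_iff\<close>)
    then show ?thesis
      using that assms
      by (simp add: laurent_at_eq_zero_iff laurent_of_eq_zero_iff frac_eq_eq flip: laurent.ev_mult)
  qed
  obtain p q where pq: "q \<noteq> 0" "ratfun_of P / ratfun_of Q = Fraction_Field.Fract p q"
    using quotient_as_Fract[OF lpolys_UNIV lpolys_UNIV assms(2)] by metis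
  show ?thesis
    unfolding laurent_expansion_def laurent_of_poly_eq
    by (rule the_equality) (use pq eq in metis)+
qed

definition CT_at :: "int \<Rightarrow> nat \<Rightarrow> 'k::field ratfun \<Rightarrow> 'k ratfun" where
  "CT_at \<sigma> j G = fls_nth (laurent_expansion j (fls_X_intpow \<sigma>) G) 0"

lemma CT_I_eq: "CT_I j (G :: 'k::field ratfun) = CT_at 1 j G + CT_at (- 1) j G"
proof -
  have "(fls_X_intpow 1 :: 'k ratfun fls) = fls_X" "(fls_X_intpow (- 1) :: 'k ratfun fls) = fls_X_inv"
    by (simp_all add: fls_X_conv_shift_1 fls_X_inv_conv_shift_1)
  then show ?thesis unfolding CT_I_def CT_zero_def CT_infinity_def CT_at_def by simp
qed

lemma CT_at_add:
  assumes "\<sigma> \<noteq> 0"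
  shows "CT_at \<sigma> j (G + H) = CT_at \<sigma> j G + CT_at \<sigma> j H"
proof -
  have quot: "\<exists>P Q. Q \<noteq> 0 \<and> G = ratfun_of P / ratfun_of Q" for G :: "'a ratfun"
    by (cases G) (metis Fract_eq_ratfun_of laurent_of_eq_zero_iff)
  obtain P Q P' Q' where PQ: "Q \<noteq> 0" "G = ratfun_of P / ratfun_of Q"
    "Q' \<noteq> 0" "H = ratfun_of P' / ratfun_of Q'"
    using quot[of G] quot[of H] by blast
  have "laurent_expansion j (fls_X_intpow \<sigma>) (G + H) =
      laurent_expansion j (fls_X_intpow \<sigma>) G + laurent_expansion j (fls_X_intpow \<sigma>) H"
    unfolding PQ quotient_add[OF PQ(1,3)] using PQ assms
    by (simp add: laurent_expansion_eq laurent_at_eq_zero_iff laurent.ev_add laurent.ev_mult add_frac_eq)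
  then show ?thesis by (simp add: CT_at_def)
qed

subsection \<open>Quotients by products of binomials\<close>

definition binomials :: "expvec list \<Rightarrow> 'k::field lpoly" where
  "binomials As = (\<Prod>A\<leftarrow>As. 1 - single A 1)"

lemma binomials_simps [simp]:
  "binomials [] = 1" "binomials (A # As) = (1 - single A 1) * binomials As"
  by (simp_all add: binomials_def)

lemma binomials_append: "binomials (As @ Bs) = binomials As * binomials Bs"
  by (simp add: binomials_def)

lemma binomial_nonzero: "A \<noteq> 0 \<Longrightarrow> 1 - single A (1::'k::field) \<noteq> 0"
proof
  assume "A \<noteq> 0" "1 - single A (1::'k) = 0"
  then have "lookup 1 A = lookup (single A (1::'k)) A" by simp
  then show False using \<open>A \<noteq> 0\<close> by (simp add: lookup_one)
qed

lemma binomials_nonzero: "0 \<notin> set As \<Longrightarrow> binomials As \<noteq> (0 :: 'k::field lpoly)"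
  by (induction As) (use binomial_nonzero in auto)

lemma binomials_in_lpolys: "set As \<subseteq> expvecs V \<Longrightarrow> binomials As \<in> lpolys V"
  unfolding binomials_def
  by (intro lpolys_prod_list) (auto intro!: lpolys_diff lpolys_one lpolys_single)

text \<open>In the expanded product the exponents are sums over sublists. Subtracting from 1 removes
  the empty sublist, so \<open>Z\<close> may be a cone without 0, for instance the exponents that
  are positive in the order.\<close>

lemma keys_one_minus_binomials:
  assumes "set As \<subseteq> Z" "\<And>a b. a \<in> Z \<Longrightarrow> b \<in> Z \<Longrightarrow> a + b \<in> Z"
  shows "keys (1 - binomials As :: 'k::field lpoly) \<subseteq> Z"
  using assms(1)
proof (induction As)
  case (Cons A As)
  let ?h = "1 - binomials As :: 'k lpoly" and ?x = "single A 1 :: 'k lpoly"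
  \<comment> \<open>This is 1 - (1 - x)(1 - h) = h + x - x h.\<close>
  have eq: "1 - binomials (A # As) = ?h + (?x - ?x * ?h)"
    by (simp add: algebra_simps)
  have h: "keys ?h \<subseteq> Z" and x: "keys ?x \<subseteq> Z" using Cons by simp_all
  have "keys (?x * ?h) \<subseteq> Z"
  proof
    fix a assume "a \<in> keys (?x * ?h)"
    then obtain b c where "a = b + c" "b \<in> keys ?x" "c \<in> keys ?h"
      using keys_mult[of ?x ?h] by blast
    then show "a \<in> Z" using h x assms(2) by blast
  qed
  then show ?case
    unfolding eq using keys_add[of ?h "?x - ?x * ?h"] keys_diff[of ?x "?x * ?h"] h x by blast
qed simp

definition restrict_keys :: "'a set \<Rightarrow> ('a \<Rightarrow>\<^sub>0 'k::comm_monoid_add) \<Rightarrow> ('a \<Rightarrow>\<^sub>0 'k)" where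
  "restrict_keys Z P = (\<Sum>a\<in>keys P \<inter> Z. single a (lookup P a))"

lemma lookup_restrict_keys: "lookup (restrict_keys Z P) a = (if a \<in> Z then lookup P a else 0)"
  by (auto simp: restrict_keys_def lookup_sum lookup_single when_def in_keys_iff)

lemma keys_restrict_keys: "keys (restrict_keys Z P) = keys P \<inter> Z"
  by (auto simp: in_keys_iff lookup_restrict_keys split: if_splits)

lemma keys_minus_restrict_keys:
  "keys (P - restrict_keys Z P :: 'a \<Rightarrow>\<^sub>0 'k::ab_group_add) = keys P - Z"
  by (auto simp: in_keys_iff lookup_minus lookup_restrict_keys split: if_splits)

text \<open>Division with remainder by ascending powers of the variable \<open>j\<close> (descending for \<open>\<sigma> = -1\<close>).\<close>

lemma ex_graded_division:
  fixes M D :: "'k::field lpoly"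
  assumes D: "D \<in> lpolys V" "\<And>a. a \<in> keys (1 - D) \<Longrightarrow> \<sigma> * lookup a j > 0" and M: "M \<in> lpolys V"
  obtains T R where "T \<in> lpolys V" "R \<in> lpolys V" "M = T * D + R"
    "\<And>a. a \<in> keys T \<Longrightarrow> \<sigma> * lookup a j \<le> 0" "\<And>a. a \<in> keys R \<Longrightarrow> \<sigma> * lookup a j > 0"
proof -
  have division: "\<exists>T R. T \<in> lpolys V \<and> R \<in> lpolys V \<and> M = T * D + R \<and>
      (\<forall>a\<in>keys T. \<sigma> * lookup a j \<le> 0) \<and> (\<forall>a\<in>keys R. \<sigma> * lookup a j > 0)"
    if "M \<in> lpolys V" "\<And>a. a \<in> keys M \<Longrightarrow> \<sigma> * lookup a j > - int n" for n M
    using that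
  proof (induction n arbitrary: M)
    case 0
    then show ?case by (intro exI[of _ 0] exI[of _ M]) (simp add: lpolys_zero)
  next
    case (Suc n)
    \<comment> \<open>The lowest slice: all \<open>\<sigma>\<close>-degrees of \<open>M\<close> are
      at least \<open>-n\<close> here, so those in \<open>M0\<close> equal
      \<open>-n\<close>.\<close>
    define M0 where "M0 = restrict_keys {a. \<sigma> * lookup a j \<le> - int n} M"
    have M0: "M0 \<in> lpolys V" using Suc.prems by (auto simp: lpolys_def M0_def keys_restrict_keys)
    have M0deg: "\<sigma> * lookup a j = - int n" if "a \<in> keys M0" for a
      using Suc.prems(2)[of a] that by (auto simp: M0_def keys_restrict_keys)
    define M1 where "M1 = M - M0"
    have M1deg: "\<sigma> * lookup a j > - int n" if "a \<in> keys M1" for a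
      using that by (auto simp: M1_def M0_def keys_minus_restrict_keys)
    \<comment> \<open>This is \<open>M - M0 * D\<close>: the lowest slice is traded for terms of
      higher degree, because 1 - D has positive degrees only.\<close>
    let ?M' = "M1 + M0 * (1 - D)"
    have "?M' \<in> lpolys V"
      using Suc.prems M0 D by (auto simp: M1_def intro!: lpolys_add lpolys_diff lpolys_mult lpolys_one)
    moreover have "\<sigma> * lookup a j > - int n" if a: "a \<in> keys ?M'" for a
    proof (cases "a \<in> keys M1")
      case False
      then obtain b c where "a = b + c" "b \<in> keys M0" "c \<in> keys (1 - D)"
        using a keys_add[of M1 "M0 * (1 - D)"] keys_mult[of M0 "1 - D"] by blast
      then show ?thesis using M0deg[of b] D(2)[of c] by (simp add: lookup_add algebra_simps)
    qed (rule M1deg)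
    ultimately obtain T R where TR: "T \<in> lpolys V" "R \<in> lpolys V" "?M' = T * D + R"
      "\<forall>a\<in>keys T. \<sigma> * lookup a j \<le> 0" "\<forall>a\<in>keys R. \<sigma> * lookup a j > 0"
      using Suc.IH[of ?M'] by blast
    have "M = (T + M0) * D + R"
      using TR(3) by (simp add: M1_def algebra_simps)
    moreover have "\<sigma> * lookup a j \<le> 0" if "a \<in> keys (T + M0)" for a
      using keys_add[of T M0] TR(4) M0deg[of a] that by auto
    ultimately show ?case
      by (intro exI[of _ "T + M0"] exI[of _ R]) (simp add: TR M0 lpolys_add)
  qed
  \<comment> \<open>The summand 1 makes the lower bound strict, as \<open>division\<close>
    requires.\<close>
  have bound: "\<sigma> * lookup a j > - int (nat (1 + (\<Sum>a\<in>keys M. \<bar>\<sigma> * lookup a j\<bar>)))" if "a \<in> keys M" for a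
  proof -
    have "\<bar>\<sigma> * lookup a j\<bar> \<le> (\<Sum>a\<in>keys M. \<bar>\<sigma> * lookup a j\<bar>)"
      using that by (intro member_le_sum) auto
    then show ?thesis by linarith
  qed
  obtain T R where "T \<in> lpolys V" "R \<in> lpolys V" "M = T * D + R"
      "\<forall>a\<in>keys T. \<sigma> * lookup a j \<le> 0" "\<forall>a\<in>keys R. \<sigma> * lookup a j > 0"
    using division[OF M bound] by blast
  then show ?thesis using that by blast
qed

lemma laurent_at_const:
  assumes "\<And>a. a \<in> keys P \<Longrightarrow> lookup a j = 0"
  shows "laurent_at \<sigma> j P = fls_const (ratfun_of P)"
  by (rule fls_eqI) (use assms in \<open>auto simp: laurent_at_nth ratfun_of_def eval_monoid_algebra_def intro!: sum.cong\<close>)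

lemma laurent_at_nth_eq_zero:
  "(\<And>a. a \<in> keys P \<Longrightarrow> \<sigma> * lookup a j \<noteq> n) \<Longrightarrow> fls_nth (laurent_at \<sigma> j P) n = 0"
  by (simp add: laurent_at_nth)

lemma fls_nth_divide_const: "fls_nth (f / fls_const c) n = fls_nth f n / (c :: 'a::field)"
proof (cases "c = 0")
  case False
  have "f / fls_const c = f * fls_const (inverse c)"
    using False by (subst divide_eq_eq) (simp add: mult.assoc)
  then show ?thesis by (simp only: fls_mult_const_nth divide_inverse)
qed simp

text \<open>The class on which all constant terms exist and which they preserve. The factors carry
  no order condition, so the same class serves an order and its reverse.\<close>

definition binomial_quotients :: "nat set \<Rightarrow> 'k::field ratfun set" where
  "binomial_quotients V =
    {ratfun_of M / ratfun_of (binomials As) | M As. M \<in> lpolys V \<and> set As \<subseteq> expvecs V - {0}}"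

lemma binomial_quotientsI:
  "M \<in> lpolys V \<Longrightarrow> set As \<subseteq> expvecs V - {0} \<Longrightarrow>
    ratfun_of M / ratfun_of (binomials As) \<in> binomial_quotients V"
  unfolding binomial_quotients_def by blast

lemma binomial_quotients_subset_ratfuns: "G \<in> binomial_quotients V \<Longrightarrow> G \<in> ratfuns V"
  unfolding binomial_quotients_def
  by (auto intro!: quotient_in_ratfuns binomials_in_lpolys binomials_nonzero)

lemma binomial_quotients_add:
  assumes "G \<in> binomial_quotients V" "H \<in> binomial_quotients V"
  shows "G + H \<in> binomial_quotients V"
proof -
  obtain M As where 1: "M \<in> lpolys V" "set As \<subseteq> expvecs V - {0}" "G = ratfun_of M / ratfun_of (binomials As)"
    using assms(1) by (auto simp: binomial_quotients_def)
  obtain N Bs where 2: "N \<in> lpolys V" "set Bs \<subseteq> expvecs V - {0}" "H = ratfun_of N / ratfun_of (binomials Bs)"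
    using assms(2) by (auto simp: binomial_quotients_def)
  have "binomials As \<noteq> (0 :: 'a lpoly)" "binomials Bs \<noteq> (0 :: 'a lpoly)"
    using 1 2 by (auto intro!: binomials_nonzero)
  then show ?thesis
    unfolding 1 2 by (subst quotient_add)
      (use 1 2 in \<open>auto simp flip: binomials_append intro!: binomial_quotientsI lpolys_add lpolys_mult binomials_in_lpolys\<close>)
qed

lemma binomial_quotients_uminus: "G \<in> binomial_quotients V \<Longrightarrow> - G \<in> binomial_quotients V"
  unfolding binomial_quotients_def
  by clarify (metis lpolys_uminus minus_divide_left rat.ev_uminus)

lemma elliott_rational_subset_binomial_quotients:
  assumes "F \<in> elliott_rational V"
  shows "F \<in> binomial_quotients V"
proof -
  obtain p m y z where F: "F = Fraction_Field.Fract p (\<Prod>i<m::nat. single (y i) 1 - single (z i) 1)"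
    and p: "p \<in> polys V" and yz: "\<And>i. i < m \<Longrightarrow> keys (y i) \<subseteq> V \<and> keys (z i) \<subseteq> V \<and> y i \<noteq> z i"
    using assms unfolding elliott_rational_def by blast
  let ?d = "\<lambda>i. single (y i) 1 - single (z i) 1 :: 'a mpoly"
  let ?A = "\<lambda>i. emb (z i) - emb (y i)"
  \<comment> \<open>Each factor y - z is divided by y, which leaves 1 - z/y; \<open>u\<close>
    collects the inverses of the y.\<close>
  define u where "u = (\<Prod>i<m. single (- emb (y i)) 1 :: 'a lpoly)"
  have A: "?A i \<in> expvecs V - {0}" if "i < m" for i
  proof -
    have "?A i \<in> expvecs V"
      using yz[OF that] by (intro diff_in_expvecs) (auto simp: expvecs_def keys_emb)
    moreover have "?A i \<noteq> 0"
      using yz[OF that] pos_part_emb[of "y i"] pos_part_emb[of "z i"] by auto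
    ultimately show ?thesis by simp
  qed
  have d: "laurent_of (\<Prod>i<m. ?d i) = (\<Prod>i<m. single (emb (y i)) 1 - single (emb (z i)) 1)"
    by (simp add: poly.ev_prod poly.ev_diff laurent_of_single)
  have "u * laurent_of (\<Prod>i<m. ?d i) = (\<Prod>i<m. 1 - single (?A i) 1)"
    unfolding d u_def prod.distrib[symmetric]
    by (intro prod.cong) (simp_all add: right_diff_distrib mult_single)
  also have "\<dots> = binomials (map ?A [0..<m])"
    by (simp add: binomials_def comp_def interv_sum_list_conv_sum_set_nat prod.list_conv_set_nth atLeast0LessThan)
  finally have eq: "u * laurent_of (\<Prod>i<m. ?d i) = binomials (map ?A [0..<m])" .
  have nz: "binomials (map ?A [0..<m]) \<noteq> (0::'a lpoly)"
    by (rule binomials_nonzero) (use A in auto)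
  then have "u \<noteq> 0" "laurent_of (\<Prod>i<m. ?d i) \<noteq> 0" by (auto simp flip: eq)
  then have "F = ratfun_of (u * laurent_of p) / ratfun_of (binomials (map ?A [0..<m]))"
    unfolding F eq[symmetric]
    by (subst Fract_eq_ratfun_of) (auto simp: laurent_of_eq_zero_iff rat.ev_mult ratfun_of_eq_zero_iff simp del: prod_zero_iff)
  also have "\<dots> \<in> binomial_quotients V"
  proof (rule binomial_quotientsI)
    show "u * laurent_of p \<in> lpolys V"
      unfolding u_def using yz
      by (intro lpolys_mult lpolys_prod lpolys_single laurent_of_in_lpolys p)
        (auto simp: expvecs_def keys_emb)
  qed (use A in auto)
  finally show ?thesis .
qed

context compatible
begin

text \<open>Write \<open>M = T D + R\<close> as in \<open>ex_graded_division\<close> and let \<open>T\<^sub>0\<close> be the \<open>j\<close>-free part of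
  \<open>T\<close>. In \<open>M / (D C) = T\<^sub>0 / C + (T - T\<^sub>0) / C + R / (D C)\<close> the last two terms have only negative and
  only positive exponents, so both constant terms are \<open>T\<^sub>0 / C\<close>.\<close>

lemma CT_one_sided:
  fixes M :: "'k::field lpoly"
  assumes \<sigma>: "\<sigma> \<noteq> 0" and M: "M \<in> lpolys V"
    and As: "\<And>A. A \<in> set As \<Longrightarrow> 0 \<sqsubset> A \<and> \<sigma> * lookup A j > 0"
    and Cs: "\<And>C. C \<in> set Cs \<Longrightarrow> 0 \<sqsubset> C \<and> lookup C j = 0"
  defines "G \<equiv> ratfun_of M / ratfun_of (binomials As * binomials Cs)"
  shows "CT_at \<sigma> j G \<in> binomial_quotients V" "is_CT j G (CT_at \<sigma> j G)"
proof -
  let ?D = "binomials As :: 'k lpoly" and ?C = "binomials Cs :: 'k lpoly"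
  have D1: "keys (1 - ?D) \<subseteq> {a. 0 \<sqsubset> a \<and> \<sigma> * lookup a j > 0}"
    by (rule keys_one_minus_binomials) (use As in \<open>auto simp: lookup_add distrib_left intro: pos_add\<close>)
  have C1: "keys (1 - ?C) \<subseteq> {a. 0 \<sqsubset> a \<and> lookup a j = 0}"
    by (rule keys_one_minus_binomials) (use Cs in \<open>auto simp: lookup_add intro: pos_add\<close>)
  have DC1: "keys (1 - ?D * ?C) \<subseteq> {a. 0 \<sqsubset> a \<and> \<sigma> * lookup a j \<ge> 0}"
    unfolding binomials_append[symmetric]
    by (rule keys_one_minus_binomials) (use As Cs in \<open>force simp: lookup_add distrib_left intro: pos_add\<close>)+
  have AsE: "set As \<subseteq> E - {0}" and CsE: "set Cs \<subseteq> E - {0}"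
    using As Cs lt_dom lt_irrefl by blast+
  have D: "?D \<in> lpolys V" "?D \<noteq> 0" and C: "?C \<in> lpolys V" "?C \<noteq> 0"
    using AsE CsE by (auto intro!: binomials_in_lpolys binomials_nonzero)
  obtain T R where T: "T \<in> lpolys V" and R: "R \<in> lpolys V" and M_eq: "M = T * ?D + R"
    and Tdeg: "\<And>a. a \<in> keys T \<Longrightarrow> \<sigma> * lookup a j \<le> 0"
    and Rdeg: "\<And>a. a \<in> keys R \<Longrightarrow> \<sigma> * lookup a j > 0"
    using ex_graded_division[OF D(1) _ M, of \<sigma> j] D1 by blast
  define T0 where "T0 = restrict_keys {a. lookup a j = 0} T"
  define T1 where "T1 = T - T0"
  have T0: "T0 \<in> lpolys V" "\<And>a. a \<in> keys T0 \<Longrightarrow> lookup a j = 0"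
    using T by (auto simp: T0_def lpolys_def keys_restrict_keys)
  have T1: "T1 \<in> lpolys V" "\<And>a. a \<in> keys T1 \<Longrightarrow> \<sigma> * lookup a j < 0"
    using T Tdeg \<sigma> by (auto simp: T1_def T0_def lpolys_def keys_minus_restrict_keys less_le)
  let ?W = "ratfun_of T0 / ratfun_of ?C"
  have W: "?W \<in> binomial_quotients V"
    using T0 CsE by (intro binomial_quotientsI)

  \<comment> \<open>The three summands are expanded separately. The third argument of
    \<open>inverse_one_minus\<close> records the sign of the \<open>j\<close>-exponents in each
    support, so that \<open>series_CT\<close> keeps exactly \<open>S0\<close>.\<close>
  obtain S0 where S0: "S0 \<in> mn_series V \<rho>" "act (1 - (1 - ?C)) S0 = lookup T0" "supp S0 \<subseteq> {a. lookup a j = 0}"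
    by (rule inverse_one_minus[of T0 "1 - ?C" "{a. lookup a j = 0}"])
      (use T0 C1 in \<open>auto simp: lpolys_def lookup_add\<close>)
  obtain S1 where S1: "S1 \<in> mn_series V \<rho>" "act (1 - (1 - ?C)) S1 = lookup T1" "supp S1 \<subseteq> {a. \<sigma> * lookup a j < 0}"
    by (rule inverse_one_minus[of T1 "1 - ?C" "{a. \<sigma> * lookup a j < 0}"])
      (use T1 C1 in \<open>auto simp: lpolys_def lookup_add distrib_left\<close>)
  obtain S2 where S2: "S2 \<in> mn_series V \<rho>" "act (1 - (1 - ?D * ?C)) S2 = lookup R" "supp S2 \<subseteq> {a. \<sigma> * lookup a j > 0}"
    by (rule inverse_one_minus[of R "1 - ?D * ?C" "{a. \<sigma> * lookup a j > 0}"])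
      (use R Rdeg DC1 in \<open>fastforce simp: lpolys_def lookup_add distrib_left\<close>)+
  define S where "S = (\<lambda>a. S0 a + S1 a + S2 a)"
  have S: "S \<in> mn_series V \<rho>"
    unfolding S_def by (intro mn_series_add S0 S1 S2)
  have "act (?D * ?C) S = (\<lambda>a. lookup (?D * T0) a + lookup (?D * T1) a + lookup R a)"
    using S0(2) S1(2) S2(2) unfolding S_def by (simp add: act_add_right act_mult_left act_lookup)
  also have "\<dots> = lookup M"
    by (simp add: M_eq T1_def algebra_simps fun_eq_iff flip: lookup_add)
  finally have "expansion V \<rho> G = S"
    unfolding G_def using S M D C by (intro expansionI) (auto intro: lpolys_mult)
  moreover have "expansion V \<rho> ?W = S0"
    using S0 T0 C by (intro expansionI) simp_all
  moreover have "series_CT j S = S0"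
  proof
    fix a
    have "S0 a = 0" if "lookup a j \<noteq> 0" using S0(3) that by (auto simp: supp_def)
    moreover have "S1 a = 0 \<and> S2 a = 0" if "lookup a j = 0"
      using S1(3) S2(3) that by (auto simp: supp_def)
    ultimately show "series_CT j S a = S0 a" by (simp add: series_CT_def S_def)
  qed
  moreover have "G \<in> ratfuns V"
    unfolding G_def using M D C by (intro quotient_in_ratfuns lpolys_mult) auto
  ultimately have is_CT: "is_CT j G ?W"
    unfolding is_CT_def using W binomial_quotients_subset_ratfuns by simp

  let ?L = "laurent_at \<sigma> j :: 'k lpoly \<Rightarrow> _"
  have LC: "?L ?C = fls_const (ratfun_of ?C)"
  proof (rule laurent_at_const)
    fix a assume "a \<in> keys ?C"
    moreover have "?C = 1 - (1 - ?C)" by simp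
    ultimately have "a = 0 \<or> a \<in> keys (1 - ?C)"
      using keys_add[of 1 "- (1 - ?C)"] by (auto simp: in_keys_iff lookup_minus lookup_one when_def split: if_splits)
    then show "lookup a j = 0" using C1 by auto
  qed
  have LD: "?L ?D \<noteq> 0" using \<sigma> D by (simp add: laurent_at_eq_zero_iff)
  have LC0: "?L ?C \<noteq> 0" using \<sigma> C by (simp add: laurent_at_eq_zero_iff)
  have "fls_nth (?L ?D) 0 = 1"
  proof -
    have "fls_nth (?L (1 - ?D)) 0 = 0" by (rule laurent_at_nth_eq_zero) (use D1 in force)
    then show ?thesis by (simp add: laurent.ev_diff laurent.ev_one)
  qed
  then have D_deg: "fls_subdegree (?L ?D) \<le> 0" by (intro fls_subdegree_leI) simp
  \<comment> \<open>\<open>R\<close> starts in positive degree and \<open>D\<close> has constant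
    coefficient 1, so the quotient again starts in positive degree.\<close>
  have R0: "fls_nth (?L R / ?L ?D) 0 = 0"
  proof (cases "R = 0")
    case False
    then have LR: "?L R \<noteq> 0" using \<sigma> by (simp add: laurent_at_eq_zero_iff)
    have "fls_subdegree (?L R) \<ge> 1"
      by (rule fls_subdegree_geI[OF LR], rule laurent_at_nth_eq_zero) (use Rdeg in force)
    moreover have "fls_subdegree (?L R) = fls_subdegree (?L R / ?L ?D) + fls_subdegree (?L ?D)"
      using fls_subdegree_mult[of "?L R / ?L ?D" "?L ?D"] LR LD by simp
    ultimately have "fls_subdegree (?L R / ?L ?D) > 0" using D_deg by linarith
    then show ?thesis by (rule fls_eq0_below_subdegree)
  qed (simp add: laurent.ev_zero)
  have "laurent_expansion j (fls_X_intpow \<sigma>) G = ?L M / ?L (?D * ?C)"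
    unfolding G_def by (rule laurent_expansion_eq) (use \<sigma> D C in auto)
  also have "\<dots> = (?L T0 + ?L T1 + ?L R / ?L ?D) / ?L ?C"
  proof -
    have "M = (T0 + T1) * ?D + R" by (simp add: M_eq T1_def)
    then show ?thesis
      using LD LC0 by (simp add: laurent.ev_add laurent.ev_mult field_simps)
  qed
  finally have "CT_at \<sigma> j G = fls_nth (?L T0 + ?L T1 + ?L R / ?L ?D) 0 / ratfun_of ?C"
    unfolding CT_at_def LC by (simp only: fls_nth_divide_const)
  moreover have "fls_nth (?L T1) 0 = 0"
    by (rule laurent_at_nth_eq_zero) (use T1(2) in force)
  moreover have "?L T0 = fls_const (ratfun_of T0)"
    by (rule laurent_at_const) (rule T0(2))
  ultimately have "CT_at \<sigma> j G = ?W" by (simp add: R0)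
  then show "CT_at \<sigma> j G \<in> binomial_quotients V" "is_CT j G (CT_at \<sigma> j G)"
    using W is_CT by simp_all
qed

end

subsection \<open>Elliott's reduction\<close>

lemma single_power_scale: "single A (1::'k::field) ^ n = single (scale n A) 1"
  by (induction n) (simp_all add: mult_single add.commute)

text \<open>Multiplying numerator and denominator by the geometric sum replaces the monomial of a
  factor by its \<open>n\<close>-th power.\<close>

lemma geometric_binomial:
  "(\<Sum>i<n. single (scale i A) (1::'k::field)) * (1 - single A 1) = 1 - single (scale n A) 1"
  using one_diff_power_eq[of "single A (1::'k)" n] by (simp add: single_power_scale mult.commute)

lemma binomials_map_uminus:
  "(\<Prod>A\<leftarrow>As. single (- A) (- 1)) * binomials As = (binomials (map uminus As) :: 'k::field lpoly)"
proof (induction As)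
  case (Cons A As)
  have "single (- A) (- 1) * (1 - single A 1) = 1 - single (- A) (1::'k)"
    by (simp add: right_diff_distrib mult_single single_uminus)
  then show ?case using Cons by (simp add: mult_ac flip: mult.assoc)
qed simp

lemma quotient_cancel_left:
  "u \<noteq> 0 \<Longrightarrow> ratfun_of (u * P) / ratfun_of (u * Q) = ratfun_of P / ratfun_of Q"
  by (simp add: rat.ev_mult ratfun_of_eq_zero_iff)

context compatible
begin

lemma compatible_converse: "compatible V (\<rho>\<inverse>)"
proof
  have "linear_order_on E (\<rho>\<inverse>)"
    using lin by simp
  then show "compatible_order V (\<rho>\<inverse>)"
    using compat by (simp add: compatible_order_def)
qed

text \<open>The reverse order is compatible too, so every result proved for the order also holds for
  its reverse.\<close>

interpretation rev: compatible V "\<rho>\<inverse>"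
  by (rule compatible_converse)

lemma rev_lt_iff: "rev.lt a b \<longleftrightarrow> b \<sqsubset> a"
  by (auto simp: lt_def rev.lt_def)

lemma neg_iff: "A \<in> E \<Longrightarrow> A \<sqsubset> 0 \<longleftrightarrow> 0 \<sqsubset> - A"
  using lt_iff_diff_pos[of A 0] by (simp add: zero_in_expvecs)

lemma rev_pos_uminus: "0 \<sqsubset> A \<Longrightarrow> rev.lt 0 (- A)"
  using neg_iff[of "- A"] lt_dom[of 0 A] by (simp add: rev_lt_iff uminus_in_expvecs)

lemma scale_pos: "0 \<sqsubset> A \<Longrightarrow> n > 0 \<Longrightarrow> 0 \<sqsubset> scale n A"
proof (induction n)
  case (Suc n)
  then show ?case by (cases "n = 0") (simp_all add: pos_add)
qed simp

text \<open>The one-variable identity bundled with existence of both constant terms and their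
  membership in the class. The bundle is additive in \<open>G\<close>, which lets it pass through
  Elliott's identity.\<close>

definition reversible :: "nat \<Rightarrow> 'k::field ratfun \<Rightarrow> bool" where
  "reversible j G \<longleftrightarrow> (\<exists>R\<in>binomial_quotients V. \<exists>R'\<in>binomial_quotients V.
    is_CT j G R \<and> rev.is_CT j G R' \<and> R + R' = CT_I j G)"

lemma reversible_add:
  assumes "reversible j G" "reversible j H"
  shows "reversible j (G + H)"
proof -
  obtain R R' where R: "R \<in> binomial_quotients V" "R' \<in> binomial_quotients V"
    "is_CT j G R" "rev.is_CT j G R'" "R + R' = CT_I j G"
    using assms(1) unfolding reversible_def by blast
  obtain T T' where T: "T \<in> binomial_quotients V" "T' \<in> binomial_quotients V"
    "is_CT j H T" "rev.is_CT j H T'" "T + T' = CT_I j H"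
    using assms(2) unfolding reversible_def by blast
  have "(R + T) + (R' + T') = CT_I j (G + H)"
    using R(5) T(5) by (simp add: CT_I_eq CT_at_add algebra_simps)
  then show ?thesis
    unfolding reversible_def using R T is_CT_add rev.is_CT_add binomial_quotients_add by blast
qed

text \<open>Passing to the reverse order turns \<open>1 / (1 - A)\<close> into \<open>- A\<inverse> / (1 - A\<inverse>)\<close>, which has the
  opposite sign of \<open>j\<close>-exponents; so the two orders give the constant terms at \<open>0\<close> and \<open>\<infinity>\<close>.\<close>

lemma reversible_one_sided:
  fixes M :: "'k::field lpoly"
  assumes \<sigma>: "\<sigma> = 1 \<or> \<sigma> = -1" and M: "M \<in> lpolys V"
    and As: "\<And>A. A \<in> set As \<Longrightarrow> 0 \<sqsubset> A \<and> \<sigma> * lookup A j > 0"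
    and Cs: "\<And>C. C \<in> set Cs \<Longrightarrow> 0 \<sqsubset> C \<and> lookup C j = 0"
  shows "reversible j (ratfun_of M / ratfun_of (binomials As * binomials Cs))" (is "reversible j ?G")
proof -
  let ?u = "(\<Prod>A\<leftarrow>As @ Cs. single (- A) (- 1)) :: 'k lpoly"
  have E: "A \<in> E - {0}" if "A \<in> set (As @ Cs)" for A
    using that As[of A] Cs[of A] lt_dom[of 0 A] lt_irrefl by auto
  have uM: "?u * M \<in> lpolys V"
    using E by (intro lpolys_mult lpolys_prod_list M) (auto intro!: lpolys_single uminus_in_expvecs)
  have eq: "?u * (binomials As * binomials Cs) = binomials (map uminus As) * binomials (map uminus Cs)"
    unfolding binomials_append[symmetric] map_append[symmetric] by (rule binomials_map_uminus)
  have "binomials (map uminus As) * binomials (map uminus Cs) \<noteq> (0 :: 'k lpoly)"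
    unfolding binomials_append[symmetric] map_append[symmetric] by (rule binomials_nonzero) (use E in auto)
  then have "?u \<noteq> 0" by (auto simp flip: eq)
  then have G: "?G = ratfun_of (?u * M) / ratfun_of (binomials (map uminus As) * binomials (map uminus Cs))"
    unfolding eq[symmetric] by (rule quotient_cancel_left[symmetric])
  have fwd: "CT_at \<sigma> j ?G \<in> binomial_quotients V" "is_CT j ?G (CT_at \<sigma> j ?G)"
    by (rule CT_one_sided; use \<sigma> M As Cs in auto)+
  have bwd: "CT_at (- \<sigma>) j ?G \<in> binomial_quotients V" "rev.is_CT j ?G (CT_at (- \<sigma>) j ?G)"
    unfolding G by (rule rev.CT_one_sided; use \<sigma> uM As Cs rev_pos_uminus in auto)+
  have "CT_at \<sigma> j ?G + CT_at (- \<sigma>) j ?G = CT_I j ?G"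
    using \<sigma> by (auto simp: CT_I_eq add.commute)
  then show ?thesis unfolding reversible_def using fwd bwd by blast
qed

text \<open>Powers of \<open>A\<close> and \<open>B\<close> with opposite \<open>j\<close>-exponents have a \<open>j\<close>-free product, and
  \<open>1 / ((1 - a) (1 - b)) = (1 / (1 - b) + 1 / (1 - a) - 1) / (1 - a b)\<close>.\<close>

lemma reversible_three_lists:
  fixes M :: "'k::field lpoly"
  assumes "M \<in> lpolys V"
    and "\<And>A. A \<in> set As \<Longrightarrow> 0 \<sqsubset> A \<and> lookup A j > 0"
    and "\<And>B. B \<in> set Bs \<Longrightarrow> 0 \<sqsubset> B \<and> lookup B j < 0"
    and "\<And>C. C \<in> set Cs \<Longrightarrow> 0 \<sqsubset> C \<and> lookup C j = 0"
  shows "reversible j (ratfun_of M / ratfun_of (binomials As * binomials Bs * binomials Cs))"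
  using assms
proof (induction "length As + length Bs" arbitrary: M As Bs Cs rule: less_induct)
  case less
  \<comment> \<open>If one list is empty, all \<open>j\<close>-exponents in the denominator have one
    weak sign; otherwise a factor from each list is combined.\<close>
  consider "Bs = []" | "As = []" | A As' B Bs' where "As = A # As'" "Bs = B # Bs'"
    by (cases As; cases Bs) auto
  then show ?case
  proof cases
    case 1
    then show ?thesis using reversible_one_sided[of 1 M As j Cs] less.prems by simp
  next
    case 2
    then show ?thesis using reversible_one_sided[of "-1" M Bs j Cs] less.prems by simp
  next
    case 3
    have A: "0 \<sqsubset> A" "lookup A j > 0" and B: "0 \<sqsubset> B" "lookup B j < 0"
      using less.prems 3 by auto
    \<comment> \<open>The two powers are chosen crosswise: in A^b B^a the \<open>j\<close>-exponents
      are a b and -a b, so they cancel.\<close>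
    define a where "a = nat (lookup A j)"
    define b where "b = nat (- lookup B j)"
    define A' where "A' = scale b A"
    define B' where "B' = scale a B"
    have A': "0 \<sqsubset> A'" "lookup A' j > 0" and B': "0 \<sqsubset> B'" "lookup B' j < 0"
      using A B by (simp_all add: A'_def B'_def a_def b_def scale_pos lookup_scale mult_pos_neg
          mult_neg_pos)
    have C': "0 \<sqsubset> A' + B'" "lookup (A' + B') j = 0"
      using pos_add[OF A'(1) B'(1)] A B by (simp_all add: A'_def B'_def a_def b_def lookup_add lookup_scale)
    \<comment> \<open>The geometric sums that turn 1 - A and 1 - B into 1 - A^b and 1 - B^a go into
      the numerator.\<close>
    define M' where "M' = (\<Sum>i<b. single (scale i A) 1) * (\<Sum>i<a. single (scale i B) 1) * M"
    have E: "A \<in> E" "B \<in> E" using A B lt_dom by blast+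
    have M': "M' \<in> lpolys V"
      unfolding M'_def using E less.prems(1)
      by (intro lpolys_mult lpolys_sum lpolys_single scale_in_expvecs)
    define \<alpha> \<beta> \<gamma> where "\<alpha> = 1 - single A' (1::'k)" "\<beta> = 1 - single B' (1::'k)" "\<gamma> = 1 - single (A' + B') (1::'k)"
    define D where "D = binomials As' * binomials Bs' * (binomials Cs :: 'k lpoly)"
    have nz: "\<alpha> \<noteq> 0" "\<beta> \<noteq> 0" "\<gamma> \<noteq> 0"
      unfolding \<alpha>_\<beta>_\<gamma>_def using A'(1) B'(1) C'(1) lt_irrefl by (metis binomial_nonzero)+
    have D: "D \<noteq> 0"
    proof -
      have "0 \<notin> set (As' @ Bs' @ Cs)" using less.prems 3 lt_irrefl by auto
      then have "binomials (As' @ Bs' @ Cs) \<noteq> (0 :: 'k lpoly)" by (rule binomials_nonzero)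
      then show ?thesis by (simp add: D_def binomials_append mult.assoc)
    qed
    let ?v = "(\<Sum>i<b. single (scale i A) 1) * (\<Sum>i<a. single (scale i B) (1::'k))"
    have \<alpha>\<beta>: "?v * (binomials As * binomials Bs * binomials Cs) = \<alpha> * \<beta> * D"
      unfolding \<alpha>_\<beta>_\<gamma>_def A'_def B'_def D_def geometric_binomial[symmetric] 3 by (simp add: mult_ac)
    have "?v \<noteq> 0"
    proof
      assume "?v = 0"
      then have "\<alpha> * \<beta> * D = 0" using \<alpha>\<beta> by (metis mult_zero_left)
      then show False using nz D by simp
    qed
    then have "ratfun_of M / ratfun_of (binomials As * binomials Bs * binomials Cs) =
        ratfun_of M' / ratfun_of (\<alpha> * \<beta> * D)"
      unfolding M'_def \<alpha>\<beta>[symmetric] by (rule quotient_cancel_left[symmetric])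
    also have "\<dots> = ratfun_of M' / ratfun_of (\<beta> * \<gamma> * D) + ratfun_of M' / ratfun_of (\<alpha> * \<gamma> * D) +
        ratfun_of (- M') / ratfun_of (\<gamma> * D)"
    proof -
      \<comment> \<open>Elliott's identity without denominators: 1 - x y = (1 - x) + (1 - y) - (1 -
        x)(1 - y).\<close>
      have "\<gamma> = \<alpha> + \<beta> - \<alpha> * \<beta>"
        by (simp add: \<alpha>_\<beta>_\<gamma>_def algebra_simps mult_single)
      then have \<gamma>: "ratfun_of \<gamma> = ratfun_of \<alpha> + ratfun_of \<beta> - ratfun_of \<alpha> * ratfun_of \<beta>"
        by (simp only: rat.ev_add rat.ev_diff rat.ev_mult)
      have aux: "m / (x * y * d) = m / (y * z * d) + m / (x * z * d) + (- m) / (z * d)"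
        if "x \<noteq> 0" "y \<noteq> 0" "z \<noteq> 0" "d \<noteq> 0" "z = x + y - x * y" for m x y z d :: "'k ratfun"
      proof -
        have "m / (y * z * d) + m / (x * z * d) + (- m) / (z * d) = m * (x + y - x * y) / (x * y * z * d)"
          using that(1-4) by (simp add: field_simps)
        also have "\<dots> = m / (x * y * d)"
          unfolding that(5)[symmetric] using that(1-4) by simp
        finally show ?thesis ..
      qed
      show ?thesis
        unfolding rat.ev_mult rat.ev_uminus
        by (rule aux[OF _ _ _ _ \<gamma>]) (use nz D in \<open>simp_all add: ratfun_of_eq_zero_iff\<close>)
    qed
    \<comment> \<open>In each term the product of the two powers moves to the \<open>j\<close>-free
      list, and at least one of the two factors is gone, so the measure drops by one, one and
      two.\<close>
    also have "reversible j \<dots>"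
    proof (intro reversible_add)
      have "reversible j (ratfun_of M' / ratfun_of (binomials As' * binomials (B' # Bs') * binomials ((A' + B') # Cs)))"
        by (rule less.hyps) (use less.prems 3 M' B' C' in auto)
      then show "reversible j (ratfun_of M' / ratfun_of (\<beta> * \<gamma> * D))"
        by (simp add: D_def \<alpha>_\<beta>_\<gamma>_def mult_ac)
      have "reversible j (ratfun_of M' / ratfun_of (binomials (A' # As') * binomials Bs' * binomials ((A' + B') # Cs)))"
        by (rule less.hyps) (use less.prems 3 M' A' C' in auto)
      then show "reversible j (ratfun_of M' / ratfun_of (\<alpha> * \<gamma> * D))"
        by (simp add: D_def \<alpha>_\<beta>_\<gamma>_def mult_ac)
      have "reversible j (ratfun_of (- M') / ratfun_of (binomials As' * binomials Bs' * binomials ((A' + B') # Cs)))"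
        by (rule less.hyps) (use less.prems 3 M' C' lpolys_uminus in auto)
      then show "reversible j (ratfun_of (- M') / ratfun_of (\<gamma> * D))"
        by (simp add: D_def \<alpha>_\<beta>_\<gamma>_def mult_ac)
    qed
    finally show ?thesis .
  qed
qed

text \<open>A factor whose monomial is below 1 is inverted at the cost of a monomial multiplier,
  collected in \<open>u\<close>; then the factors are sorted by the sign of their
  \<open>j\<close>-exponent.\<close>

lemma ex_three_lists:
  assumes "set Ds \<subseteq> E - {0}"
  shows "\<exists>u As Bs Cs. u \<in> lpolys V \<and> u \<noteq> (0 :: 'k::field lpoly) \<and>
    u * binomials Ds = binomials As * binomials Bs * binomials Cs \<and>
    (\<forall>A\<in>set As. 0 \<sqsubset> A \<and> lookup A j > 0) \<and> (\<forall>B\<in>set Bs. 0 \<sqsubset> B \<and> lookup B j < 0) \<and>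
    (\<forall>C\<in>set Cs. 0 \<sqsubset> C \<and> lookup C j = 0)"
  using assms
proof (induction Ds)
  case Nil
  show ?case by (intro exI[of _ 1] exI[of _ "[]"]) (simp add: lpolys_one)
next
  case (Cons D Ds)
  then obtain u :: "'k lpoly" and As Bs Cs where u: "u \<in> lpolys V" "u \<noteq> 0"
    and eq: "u * binomials Ds = binomials As * binomials Bs * binomials Cs"
    and pos: "\<forall>A\<in>set As. 0 \<sqsubset> A \<and> lookup A j > 0" "\<forall>B\<in>set Bs. 0 \<sqsubset> B \<and> lookup B j < 0"
      "\<forall>C\<in>set Cs. 0 \<sqsubset> C \<and> lookup C j = 0" by auto
  have D: "D \<in> E" "D \<noteq> 0" using Cons.prems by auto
  \<comment> \<open>For D below 1 the multiplier is -1/D, since (-1/D)(1 - D) = 1 - 1/D; otherwise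
    it is 1.\<close>
  obtain D' and w :: "'k lpoly" where D': "0 \<sqsubset> D'" and w: "w \<in> lpolys V" "w \<noteq> 0"
    and weq: "w * (1 - single D 1) = 1 - single D' 1"
  proof (cases "0 \<sqsubset> D")
    case True
    then show ?thesis by (rule that[of _ 1]) (simp_all add: lpolys_one)
  next
    case False
    then have "0 \<sqsubset> - D" using lt_total[OF D(1) zero_in_expvecs] D(2) neg_iff[OF D(1)] by auto
    moreover have "single (- D) (- 1 :: 'k) \<noteq> 0"
      using single_one_nonzero[of "- D"] by (simp add: single_uminus)
    ultimately show ?thesis
      by (intro that[of "- D" "single (- D) (- 1)"])
        (use D in \<open>auto simp: right_diff_distrib mult_single single_uminus intro!: lpolys_single lpolys_uminus uminus_in_expvecs\<close>)
  qed
  have uw: "u * w \<in> lpolys V" "u * w \<noteq> 0" using u w by (auto intro: lpolys_mult)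
  have "u * w * binomials (D # Ds) = (w * (1 - single D 1)) * (u * binomials Ds)" by (simp add: mult_ac)
  then have eq': "u * w * binomials (D # Ds) = (1 - single D' 1) * (binomials As * binomials Bs * binomials Cs)"
    by (simp only: eq weq)
  consider "lookup D' j > 0" | "lookup D' j < 0" | "lookup D' j = 0" by linarith
  then show ?case
  proof cases
    case 1
    then show ?thesis using uw eq' D' pos
      by (intro exI[of _ "u * w"] exI[of _ "D' # As"] exI[of _ Bs] exI[of _ Cs]) (auto simp: mult_ac)
  next
    case 2
    then show ?thesis using uw eq' D' pos
      by (intro exI[of _ "u * w"] exI[of _ As] exI[of _ "D' # Bs"] exI[of _ Cs]) (auto simp: mult_ac)
  next
    case 3
    then show ?thesis using uw eq' D' pos
      by (intro exI[of _ "u * w"] exI[of _ As] exI[of _ Bs] exI[of _ "D' # Cs"]) (auto simp: mult_ac)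
  qed
qed

lemma reversible_binomial_quotient:
  assumes "G \<in> binomial_quotients V"
  shows "reversible j (G :: 'k::field ratfun)"
proof -
  obtain M Ds where M: "M \<in> lpolys V" and Ds: "set Ds \<subseteq> E - {0}"
    and G: "G = ratfun_of M / ratfun_of (binomials Ds)"
    using assms by (auto simp: binomial_quotients_def)
  obtain u :: "'k lpoly" and As Bs Cs where u: "u \<in> lpolys V" "u \<noteq> 0"
    and eq: "u * binomials Ds = binomials As * binomials Bs * binomials Cs"
    and pos: "\<forall>A\<in>set As. 0 \<sqsubset> A \<and> lookup A j > 0" "\<forall>B\<in>set Bs. 0 \<sqsubset> B \<and> lookup B j < 0"
      "\<forall>C\<in>set Cs. 0 \<sqsubset> C \<and> lookup C j = 0"
    using ex_three_lists[OF Ds, of j] by blast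
  have "G = ratfun_of (u * M) / ratfun_of (binomials As * binomials Bs * binomials Cs)"
    unfolding G eq[symmetric] by (rule quotient_cancel_left[OF u(2), symmetric])
  then show ?thesis
    using reversible_three_lists[of "u * M" As j Bs Cs] pos lpolys_mult[OF u(1) M] by auto
qed

text \<open>On the class the witnesses of \<open>reversible\<close> are the values of the definite
  descriptions, so the bundle becomes an identity between operators. Membership of the results
  allows iteration.\<close>

lemma
  assumes "G \<in> binomial_quotients V"
  shows CT_in_binomial_quotients: "CT V \<rho> j G \<in> binomial_quotients V"
    and is_CT_CT: "is_CT j G (CT V \<rho> j G)"
    and CT_converse: "CT V (\<rho>\<inverse>) j G = - CT V \<rho> j G + CT_I j G"
    and CT_I_in_binomial_quotients: "CT_I j G \<in> binomial_quotients V"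
proof -
  obtain R R' where R: "R \<in> binomial_quotients V" "R' \<in> binomial_quotients V"
    "is_CT j G R" "rev.is_CT j G R'" "R + R' = CT_I j G"
    using reversible_binomial_quotient[OF assms, of j] unfolding reversible_def by blast
  show "CT V \<rho> j G \<in> binomial_quotients V" "is_CT j G (CT V \<rho> j G)"
    "CT V (\<rho>\<inverse>) j G = - CT V \<rho> j G + CT_I j G"
    using R CT_eq[OF R(3)] rev.CT_eq[OF R(4)] by (auto simp flip: R(5))
  show "CT_I j G \<in> binomial_quotients V"
    unfolding R(5)[symmetric] by (rule binomial_quotients_add) (rule R)+
qed

section \<open>Additivity of iterated constant terms\<close>

lemma CT_add:
  assumes "G \<in> binomial_quotients V" "H \<in> binomial_quotients V"
  shows "CT V \<rho> j (G + H) = CT V \<rho> j G + CT V \<rho> j H"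
  using assms by (intro CT_eq is_CT_add is_CT_CT)

lemma fold_CT_in_binomial_quotients:
  "G \<in> binomial_quotients V \<Longrightarrow> fold (CT V \<rho>) js G \<in> binomial_quotients V"
  by (induction js arbitrary: G) (simp_all add: CT_in_binomial_quotients)

lemma fold_CT_add:
  "G \<in> binomial_quotients V \<Longrightarrow> H \<in> binomial_quotients V \<Longrightarrow>
    fold (CT V \<rho>) js (G + H) = fold (CT V \<rho>) js G + fold (CT V \<rho>) js H"
  by (induction js arbitrary: G H) (simp_all add: CT_in_binomial_quotients CT_add)

lemma zero_in_binomial_quotients: "0 \<in> binomial_quotients V"
  using binomial_quotientsI[of 0 V "[]"] by (simp add: lpolys_zero rat.ev_zero)

lemma fold_CT_uminus:
  assumes "G \<in> binomial_quotients V"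
  shows "fold (CT V \<rho>) js (- G) = - fold (CT V \<rho>) js G"
proof -
  \<comment> \<open>Additivity at 0 + 0 forces the value 0.\<close>
  have "fold (CT V \<rho>) js 0 = (0 :: 'a ratfun)"
    using fold_CT_add[OF zero_in_binomial_quotients zero_in_binomial_quotients, of js]
    by (metis add_0 add_cancel_right_right)
  then show ?thesis
    using fold_CT_add[OF assms binomial_quotients_uminus[OF assms], of js] by (simp add: add_eq_0_iff)
qed

end

theorem theorem3p8:
  fixes r n :: nat
    and \<rho> :: "expvec rel"
    and F :: "'k::field ratfun"
  defines "V \<equiv> {1..r + n}"
  assumes "F \<in> elliott_rational V"
    and "compatible_order V \<rho>"
  shows "fold (CT V (\<rho>\<inverse>)) [1..<r+1] F =
    (-1) ^ r * fold (CT V \<rho>) [1..<r+1] F +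
    (\<Sum>i<r. (-1) ^ i * fold (CT V (\<rho>\<inverse>)) [i+2..<r+1] (CT_I (i+1) (fold (CT V \<rho>) [1..<i+1] F)))"
proof -
  interpret compatible V \<rho> by unfold_locales (rule assms(3))
  interpret rev: compatible V "\<rho>\<inverse>" by (rule compatible_converse)
  have F: "F \<in> binomial_quotients V"
    by (rule elliott_rational_subset_binomial_quotients) (rule assms(2))
  \<comment> \<open>Telescoping: after \<open>k\<close> steps the operators for the first
    \<open>k\<close> variables use the original order and the remaining ones still use its
    reverse.\<close>
  have "fold (CT V (\<rho>\<inverse>)) [1..<r+1] F =
    (-1) ^ k * fold (CT V (\<rho>\<inverse>)) [k+1..<r+1] (fold (CT V \<rho>) [1..<k+1] F) +
    (\<Sum>i<k. (-1) ^ i * fold (CT V (\<rho>\<inverse>)) [i+2..<r+1] (CT_I (i+1) (fold (CT V \<rho>) [1..<i+1] F)))"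
    if "k \<le> r" for k
    using that
  proof (induction k)
    case (Suc k)
    let ?G = "fold (CT V \<rho>) [1..<k+1] F"
    let ?js = "[k+2..<r+1]"
    have G: "?G \<in> binomial_quotients V" by (rule fold_CT_in_binomial_quotients[OF F])
    \<comment> \<open>\<open>fold\<close> applies the head of the list first, so the next operator
      to be exchanged is the one for variable \<open>k+1\<close>.\<close>
    have "[k+1..<r+1] = (k+1) # ?js" using Suc.prems by (simp add: upt_conv_Cons)
    then have "fold (CT V (\<rho>\<inverse>)) [k+1..<r+1] ?G = fold (CT V (\<rho>\<inverse>)) ?js (- CT V \<rho> (k+1) ?G + CT_I (k+1) ?G)"
      by (simp only: fold_simps CT_converse[OF G])
    also have "\<dots> = - fold (CT V (\<rho>\<inverse>)) ?js (CT V \<rho> (k+1) ?G) + fold (CT V (\<rho>\<inverse>)) ?js (CT_I (k+1) ?G)"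
      by (simp only: rev.fold_CT_add rev.fold_CT_uminus binomial_quotients_uminus
          CT_in_binomial_quotients[OF G] CT_I_in_binomial_quotients[OF G])
    also have "CT V \<rho> (k+1) ?G = fold (CT V \<rho>) [1..<Suc k+1] F"
      by simp
    finally have step: "fold (CT V (\<rho>\<inverse>)) [k+1..<r+1] ?G =
      - fold (CT V (\<rho>\<inverse>)) ?js (fold (CT V \<rho>) [1..<Suc k+1] F) + fold (CT V (\<rho>\<inverse>)) ?js (CT_I (k+1) ?G)" .
    have "k \<le> r" using Suc.prems by simp
    then show ?case
      unfolding Suc.IH[OF \<open>k \<le> r\<close>] step by (simp add: algebra_simps del: upt_Suc)
  qed simp
  \<comment> \<open>At \<open>k = r\<close> the list of remaining variables is empty and its
    \<open>fold\<close> is the identity.\<close>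
  from this[of r] show ?thesis by simp
qed

end
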